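(* Let $w\in S_n$ and $\alpha=(\alpha_1,\ldots,\alpha_n)\in\mathbb{Z}_{\ge 0}^n$, and let $c_{\alpha,w}$ be the coefficient of $x_1^{\alpha_1}\cdots x_n^{\alpha_n}$ in the Schubert polynomial $\mathfrak{S}_w$. Then $$c_{\alpha,w}>0\iff \mathsf{PerfectTab}(D(w),\alpha)\neq\emptyset\iff \mathsf{PerfectTab}_{<}(D(w),\alpha)\neq\emptyset .$$
   Context: For $w\in S_n$ the Schubert polynomial $\mathfrak{S}_w(x_1,\ldots,x_n)$ is defined recursively. If $w_0=n\ (n-1)\cdots 2\ 1$ is the longest element of $S_n$, then $\mathfrak{S}_{w_0}=x_1^{n-1}x_2^{n-2}\cdots x_{n-1}$. Otherwise there is $i$ with $w(i)<w(i+1)$, and $\mathfrak{S}_w=\partial_i\mathfrak{S}_{ws_i}$, where $s_i$ is the transposition swapping $i$ and $i+1$ and $\partial_i f=\frac{f-s_if}{x_i-x_{i+1}}$ ($s_i$ acting on $f$ by exchanging $x_i$ and $x_{i+1}$). This is well defined, and the coefficients are nonnegative integers. The Rothe diagram of $w\in S_n$ is $D(w)=\{(i,j)\in[n]^2: j<w(i),\ i<w^{-1}(j)\}$, where $(i,j)$ is the box in row $i$ (from the top) and column $j$ (from the left). $\mathsf{PerfectTab}(D(w),\alpha)$ is the set of fillings $\tau:D(w)\to[n]$ using exactly $\alpha_k$ many $k$'s for each $k\in[n]$, such that the entries in each column are distinct and every entry in row $i$ is $\le i$. $\mathsf{PerfectTab}_{<}(D(w),\alpha)\subseteq\mathsf{PerfectTab}(D(w),\alpha)$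 is the subset of fillings whose entries in each column strictly increase from top to bottom. *)

theory Defs
  imports Complex_Main "HOL-Library.Poly_Mapping" "HOL-Library.FuncSet"
    "HOL-Combinatorics.Permutations"
begin

text \<open>Integer polynomials in variables \<open>x\<^sub>1, x\<^sub>2, \<dots>\<close>: finitely supported maps from
  exponent vectors to coefficients. Multiplication on \<^typ>\<open>(nat \<Rightarrow>\<^sub>0 nat) \<Rightarrow>\<^sub>0 int\<close> is
  convolution, hence polynomial multiplication.\<close>

type_synonym expvec = "nat \<Rightarrow>\<^sub>0 nat"
type_synonym zpoly = "expvec \<Rightarrow>\<^sub>0 int"

definition var :: "nat \<Rightarrow> zpoly" where
  "var i = Poly_Mapping.single (Poly_Mapping.single i 1) 1"

definition coeff :: "zpoly \<Rightarrow> expvec \<Rightarrow> int" where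
  "coeff f \<alpha> = Poly_Mapping.lookup f \<alpha>"

text \<open>The inner \<open>map_key\<close> exchanges the exponents of \<open>x\<^sub>i\<close> and \<open>x\<^sub>i\<^sub>+\<^sub>1\<close> in an exponent vector.
  Both maps of indices are involutions, so pulling back along them is the same as pushing
  forward.\<close>

definition swap_vars :: "nat \<Rightarrow> zpoly \<Rightarrow> zpoly" where
  "swap_vars i f = Poly_Mapping.map_key (Poly_Mapping.map_key (transpose i (i + 1))) f"

text \<open>The polynomial ring is an integral domain and \<open>x\<^sub>i - x\<^sub>i\<^sub>+\<^sub>1\<close> divides \<open>f - s\<^sub>i f\<close>, so the
  quotient below exists and is unique.\<close>

definition divdiff :: "nat \<Rightarrow> zpoly \<Rightarrow> zpoly" where
  "divdiff i f = (THE g. (var i - var (i + 1)) * g = f - swap_vars i f)"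

text \<open>Permutations of \<open>{1..n}\<close> are functions \<open>w\<close> with \<^term>\<open>w permutes {1..n}\<close>.\<close>

definition longest_perm :: "nat \<Rightarrow> nat \<Rightarrow> nat" where
  "longest_perm n i = (if i \<in> {1..n} then n + 1 - i else i)"

text \<open>\<open>schubert_rel n w f\<close>: the recursion yields \<open>f\<close> from \<open>w \<in> S\<^sub>n\<close> for some sequence of choices
  of ascents \<open>i\<close>. The well-definedness of Schubert polynomials says that for each \<open>w\<close> there is
  exactly one such \<open>f\<close>.\<close>

inductive schubert_rel :: "nat \<Rightarrow> (nat \<Rightarrow> nat) \<Rightarrow> zpoly \<Rightarrow> bool" for n where
  longest: "schubert_rel n (longest_perm n) (\<Prod>i = 1..n. var i ^ (n - i))"
| ascent: "w permutes {1..n} \<Longrightarrow> i \<in> {1..<n} \<Longrightarrow> w i < w (i + 1) \<Longrightarrow>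
    schubert_rel n (w \<circ> transpose i (i + 1)) f \<Longrightarrow> schubert_rel n w (divdiff i f)"

definition schubert :: "nat \<Rightarrow> (nat \<Rightarrow> nat) \<Rightarrow> zpoly" where
  "schubert n w = (THE f. schubert_rel n w f)"

definition rothe_diagram :: "nat \<Rightarrow> (nat \<Rightarrow> nat) \<Rightarrow> (nat \<times> nat) set" where
  "rothe_diagram n w = {(i, j) \<in> {1..n} \<times> {1..n}. j < w i \<and> i < inv w j}"

definition perfect_tab :: "nat \<Rightarrow> (nat \<times> nat) set \<Rightarrow> expvec \<Rightarrow> (nat \<times> nat \<Rightarrow> nat) set" where
  "perfect_tab n D \<alpha> = {\<tau> \<in> D \<rightarrow>\<^sub>E {1..n}.
     (\<forall>k \<in> {1..n}. card {b \<in> D. \<tau> b = k} = Poly_Mapping.lookup \<alpha> k) \<and>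
     (\<forall>i i' j. (i, j) \<in> D \<and> (i', j) \<in> D \<and> i \<noteq> i' \<longrightarrow> \<tau> (i, j) \<noteq> \<tau> (i', j)) \<and>
     (\<forall>i j. (i, j) \<in> D \<longrightarrow> \<tau> (i, j) \<le> i)}"

definition perfect_tab_less :: "nat \<Rightarrow> (nat \<times> nat) set \<Rightarrow> expvec \<Rightarrow> (nat \<times> nat \<Rightarrow> nat) set" where
  "perfect_tab_less n D \<alpha> = {\<tau> \<in> perfect_tab n D \<alpha>.
     \<forall>i i' j. (i, j) \<in> D \<and> (i', j) \<in> D \<and> i < i' \<longrightarrow> \<tau> (i, j) < \<tau> (i', j)}"

end

theory Submission
  imports Defs "HOL-Library.Infinite_Set"
begin

text \<open>Let \<open>r\<close> be the first row in which \<open>w\<close> differs from the longest permutation. Monk's rule then has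
  no negative terms: \<open>x\<^sub>r \<SS>\<^sub>w\<close> is the sum of the \<open>\<SS>\<^sub>v\<close> over the covers \<open>v = w t\<^sub>r\<^sub>s\<close>, which gives
  nonnegativity and a recursion for the support. A filling matters only through the set \<open>E\<^sub>j\<close> of
  entries in each column \<open>j\<close>, and \<open>E\<^sub>j\<close> may be any set that is componentwise at most the set of rows of
  that column, since its elements can be placed in increasing order. The possible contents of such
  families satisfy the same recursion: passing from \<open>w\<close> to a cover moves one column, adds a box
  in row \<open>r\<close>, and moves boxes from row \<open>s\<close> up to row \<open>r\<close> in the columns in between; conversely,
  exchanging initial segments of columns brings any family into a form that comes from a cover.\<close>

section \<open>Divided differences\<close>

text \<open>In general, Monk's rule subtracts the upward covers that swap row \<open>r\<close> with
  an earlier row, and it may leave \<open>S_n\<close>. Here the earlier rows carry the largest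
  values, so no such swap goes up, and the value \<open>n + 1 - r\<close>, still to come after row
  \<open>r\<close>, blocks any cover by a position beyond \<open>n\<close>. Multiplication by
  \<open>x_r\<close> only shifts exponents. With nonnegative coefficients nothing cancels, so the
  support for \<open>w\<close> is a union over the covers, and the combinatorial side needs
  existence only, not a bijection. The obstacle lies in passing from a filling for \<open>w\<close>
  to one for a cover. The column \<open>w s\<close> must lack the entry \<open>r\<close>, and every
  column strictly between \<open>w r\<close> and \<open>w s\<close> must have a strict surplus of
  small entries so that a box can rise from row \<open>s\<close> to row \<open>r\<close>. Neither
  holds for an arbitrary filling or an arbitrary cover, so the two are chosen together by a
  minimality argument.\<close>

lemma poly_mapping_sum_induct [case_names single add]:
  fixes f :: "'a \<Rightarrow>\<^sub>0 'b::comm_monoid_add"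
  assumes single: "\<And>a c. P (Poly_Mapping.single a c)"
    and add: "\<And>f g. P f \<Longrightarrow> P g \<Longrightarrow> P (f + g)"
  shows "P f"
proof (induction f rule: Poly_Mapping.update_induct)
  case const
  show ?case using single[of undefined 0] by simp
next
  case (update f a b)
  have "Poly_Mapping.update a b f = f + Poly_Mapping.single a b"
    using update(1)
    by (intro poly_mapping_eqI) (auto simp: lookup_update lookup_add lookup_single when_def in_keys_iff)
  then show ?case using add[OF update(3) single[of a b]] by simp
qed

text \<open>Constants and variables generate the ring. Identities between the ring maps
  \<open>swap_vars i\<close> thus reduce to variables, where they are identities of
  transpositions.\<close>

lemma zpoly_induct [case_names const var add mult]:
  fixes f :: zpoly
  assumes const: "\<And>c. P (Poly_Mapping.single 0 c)" and var: "\<And>i. P (var i)"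
    and add: "\<And>f g. P f \<Longrightarrow> P g \<Longrightarrow> P (f + g)"
    and mult: "\<And>f g. P f \<Longrightarrow> P g \<Longrightarrow> P (f * g)"
  shows "P f"
proof (induction f rule: poly_mapping_sum_induct)
  case (single a c)
  have pow: "P (Poly_Mapping.single (Poly_Mapping.single i m) 1)" for i m
  proof (induction m)
    case 0
    show ?case using const[of 1] by simp
  next
    case (Suc m)
    have "Poly_Mapping.single (Poly_Mapping.single i (Suc m)) 1
        = var i * Poly_Mapping.single (Poly_Mapping.single i m) (1::int)"
      by (simp add: var_def mult_single flip: single_add)
    then show ?case using mult[OF var Suc] by simp
  qed
  have "P (Poly_Mapping.single a 1)"
  proof (induction a rule: poly_mapping_sum_induct)
    case (single i m)
    show ?case by (rule pow)
  next
    case (add a b)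
    have "Poly_Mapping.single (a + b) (1::int) = Poly_Mapping.single a 1 * Poly_Mapping.single b 1"
      by (simp add: mult_single)
    then show ?case using mult[OF add] by simp
  qed
  then have "P (Poly_Mapping.single 0 c * Poly_Mapping.single a 1)"
    by (rule mult[OF const])
  then show ?case by (simp add: mult_single)
qed (rule add)

lemma lookup_map_key: "inj h \<Longrightarrow> Poly_Mapping.lookup (Poly_Mapping.map_key h p) k = Poly_Mapping.lookup p (h k)"
  by (simp add: map_key.rep_eq)

lemma map_key_inverse:
  assumes "\<And>x. h (h x) = x"
  shows "Poly_Mapping.map_key h (Poly_Mapping.map_key h p) = p"
proof -
  have "inj h" by (metis assms injI)
  then show ?thesis by (intro poly_mapping_eqI) (simp add: lookup_map_key assms)
qed

section \<open>Adjacent transpositions acting on exponents and on polynomials\<close>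

definition swap_exp :: "nat \<Rightarrow> expvec \<Rightarrow> expvec" where
  "swap_exp i = Poly_Mapping.map_key (transpose i (i + 1))"

lemma swap_exp_swap_exp [simp]: "swap_exp i (swap_exp i a) = a"
  unfolding swap_exp_def by (rule map_key_inverse) simp

lemma inj_swap_exp: "inj (swap_exp i)"
  by (metis swap_exp_swap_exp injI)

lemma lookup_swap_exp [simp]:
  "Poly_Mapping.lookup (swap_exp i a) k = Poly_Mapping.lookup a (transpose i (i + 1) k)"
  by (simp add: swap_exp_def lookup_map_key)

lemma swap_exp_single: "swap_exp i (Poly_Mapping.single k m) = Poly_Mapping.single (transpose i (i + 1) k) m"
  by (intro poly_mapping_eqI) (auto simp: lookup_single when_def transpose_eq_iff)

lemma swap_exp_add: "swap_exp i (a + b) = swap_exp i a + swap_exp i b"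
  by (intro poly_mapping_eqI) (simp add: lookup_add)

lemma swap_vars_alt: "swap_vars i = Poly_Mapping.map_key (swap_exp i)"
  by (simp add: fun_eq_iff swap_vars_def swap_exp_def)

lemma swap_vars_swap_vars [simp]: "swap_vars i (swap_vars i f) = f"
  unfolding swap_vars_alt by (rule map_key_inverse) simp

lemma lookup_swap_vars: "Poly_Mapping.lookup (swap_vars i f) a = Poly_Mapping.lookup f (swap_exp i a)"
  by (simp add: swap_vars_alt lookup_map_key inj_swap_exp)

lemma swap_vars_single: "swap_vars i (Poly_Mapping.single a c) = Poly_Mapping.single (swap_exp i a) c"
  by (intro poly_mapping_eqI) (auto simp: lookup_swap_vars lookup_single when_def)

lemma swap_vars_add: "swap_vars i (f + g) = swap_vars i f + swap_vars i g"
  by (intro poly_mapping_eqI) (simp add: lookup_swap_vars lookup_add)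

lemma swap_vars_diff: "swap_vars i (f - g) = swap_vars i f - swap_vars i g"
  by (intro poly_mapping_eqI) (simp add: lookup_swap_vars lookup_minus)

lemma swap_vars_mult: "swap_vars i (f * g) = swap_vars i f * swap_vars i g"
proof (induction f rule: poly_mapping_sum_induct)
  case (single a c)
  show ?case
    by (induction g rule: poly_mapping_sum_induct)
      (simp_all add: mult_single swap_vars_single swap_exp_add distrib_left swap_vars_add)
next
  case (add f1 f2)
  then show ?case by (simp add: distrib_right swap_vars_add)
qed

lemma swap_vars_var: "swap_vars i (var k) = var (transpose i (i + 1) k)"
  by (simp add: var_def swap_vars_single swap_exp_single)

lemma swap_vars_const: "swap_vars i (Poly_Mapping.single 0 c) = Poly_Mapping.single 0 c"
proof -
  have "swap_exp i 0 = 0" by (intro poly_mapping_eqI) simp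
  then show ?thesis by (simp add: swap_vars_single)
qed

lemma swap_vars_1: "swap_vars i 1 = 1"
  using swap_vars_const[of i 1] by simp

lemma swap_vars_power: "swap_vars i (f ^ m) = swap_vars i f ^ m"
  by (induction m) (simp_all add: swap_vars_1 swap_vars_mult)

lemma swap_vars_prod: "swap_vars i (prod g A) = (\<Prod>x\<in>A. swap_vars i (g x))"
  by (induction A rule: infinite_finite_induct) (simp_all add: swap_vars_1 swap_vars_mult)

lemma swap_vars_commute:
  assumes "i + 1 < j"
  shows "swap_vars i (swap_vars j f) = swap_vars j (swap_vars i f)"
proof (induction f rule: zpoly_induct)
  case (var k)
  show ?case using assms by (auto simp: swap_vars_var transpose_def)
qed (simp_all add: swap_vars_const swap_vars_add swap_vars_mult)

lemma swap_vars_braid: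
  "swap_vars i (swap_vars (i + 1) (swap_vars i f)) = swap_vars (i + 1) (swap_vars i (swap_vars (i + 1) f))"
proof (induction f rule: zpoly_induct)
  case (var k)
  show ?case by (auto simp: swap_vars_var transpose_def)
qed (simp_all add: swap_vars_const swap_vars_add swap_vars_mult)

section \<open>Divided differences as exact quotients\<close>

lemma var_eq_iff: "var i = var j \<longleftrightarrow> i = j"
proof
  assume "var i = var j"
  then have "Poly_Mapping.lookup (var i) (Poly_Mapping.single i 1) = Poly_Mapping.lookup (var j) (Poly_Mapping.single i 1)"
    by simp
  then have "Poly_Mapping.single j (1::nat) = Poly_Mapping.single i 1"
    by (simp add: var_def lookup_single when_def split: if_splits)
  then have "Poly_Mapping.lookup (Poly_Mapping.single j (1::nat)) i = 1" by simp
  then show "i = j" by (simp add: lookup_single when_def split: if_splits)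
qed simp

text \<open>The polynomials with this property contain the generators and are closed under sums and,
  by the twisted Leibniz rule, under products.\<close>

lemma var_diff_dvd: "(var i - var (i + 1)) dvd (f - swap_vars i f)"
proof (induction f rule: zpoly_induct)
  case (var k)
  have "var k - var (transpose i (i + 1) k) \<in> {0, var i - var (i + 1), - (var i - var (i + 1))}"
    by (auto simp: transpose_def)
  then show ?case unfolding swap_vars_var by (auto simp only: insert_iff empty_iff dvd_0_right dvd_refl dvd_minus_iff)
next
  case (add f g)
  have "f + g - swap_vars i (f + g) = (f - swap_vars i f) + (g - swap_vars i g)"
    by (simp add: swap_vars_add)
  then show ?case using add by (simp only: dvd_add)
next
  case (mult f g)
  have "f * g - swap_vars i (f * g) = f * (g - swap_vars i g) + (f - swap_vars i f) * swap_vars i g"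
    by (simp add: swap_vars_mult algebra_simps)
  then show ?case using mult by simp
qed (simp add: swap_vars_const)

text \<open>Cancellation in an integral domain. It replaces the definite description: later
  identities for \<open>divdiff\<close> are checked after multiplication by
  \<open>var i - var (i + 1)\<close>.\<close>

lemma divdiff_unique:
  assumes "(var i - var (i + 1)) * g = f - swap_vars i f"
  shows "divdiff i f = g"
  unfolding divdiff_def
proof (rule the_equality[where a = g])
  fix h assume "(var i - var (i + 1)) * h = f - swap_vars i f"
  with assms have "(var i - var (i + 1)) * h = (var i - var (i + 1)) * g" by simp
  then show "h = g" by (simp add: var_eq_iff)
qed (rule assms)

lemma divdiff_eq: "(var i - var (i + 1)) * divdiff i f = f - swap_vars i f"
proof -
  obtain g where g: "f - swap_vars i f = (var i - var (i + 1)) * g"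
    by (rule dvdE[OF var_diff_dvd])
  then have "divdiff i f = g" by (intro divdiff_unique) simp
  with g show ?thesis by simp
qed

lemma swap_vars_divdiff [simp]: "swap_vars i (divdiff i f) = divdiff i f"
proof -
  have "(var (i + 1) - var i) * swap_vars i (divdiff i f) = swap_vars i ((var i - var (i + 1)) * divdiff i f)"
    by (simp add: swap_vars_mult swap_vars_diff swap_vars_var)
  also have "\<dots> = - ((var i - var (i + 1)) * divdiff i f)"
    unfolding divdiff_eq by (simp add: swap_vars_diff)
  finally have "(var (i + 1) - var i) * swap_vars i (divdiff i f) = (var (i + 1) - var i) * divdiff i f"
    by (simp add: algebra_simps)
  then show ?thesis by (simp add: var_eq_iff)
qed

lemma divdiff_add: "divdiff i (f + g) = divdiff i f + divdiff i g"
  by (rule divdiff_unique) (simp add: distrib_left divdiff_eq[simplified] swap_vars_add)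

lemma divdiff_0: "divdiff i 0 = 0"
  by (rule divdiff_unique) (metis mult_zero_right diff_self swap_vars_const single_zero)

lemma divdiff_sum: "divdiff i (sum g A) = (\<Sum>x\<in>A. divdiff i (g x))"
  by (induction A rule: infinite_finite_induct) (simp_all add: divdiff_add divdiff_0)

lemma divdiff_symmetric: "swap_vars i f = f \<Longrightarrow> divdiff i f = 0"
  by (rule divdiff_unique) simp

lemma divdiff_mult_symmetric:
  assumes "swap_vars i g = g"
  shows "divdiff i (g * f) = g * divdiff i f"
proof (rule divdiff_unique)
  have "(var i - var (i + 1)) * (g * divdiff i f) = g * ((var i - var (i + 1)) * divdiff i f)"
    by (simp only: ac_simps)
  also have "\<dots> = g * f - swap_vars i (g * f)"
    unfolding divdiff_eq by (simp add: right_diff_distrib swap_vars_mult assms)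
  finally show "(var i - var (i + 1)) * (g * divdiff i f) = g * f - swap_vars i (g * f)" .
qed

text \<open>Twisted Leibniz rule, with the divided difference of \<open>var (i + 1)\<close> equal to
  -1. The term \<open>- f\<close> later accounts for the one additional cover when the cotransition
  formula passes from row \<open>r + 1\<close> to row \<open>r\<close>.\<close>

lemma divdiff_var_mult: "divdiff i (var (i + 1) * f) = var i * divdiff i f - f"
proof (rule divdiff_unique)
  have "(var i - var (i + 1)) * (var i * divdiff i f - f)
      = var i * ((var i - var (i + 1)) * divdiff i f) - (var i - var (i + 1)) * f"
    by (simp only: algebra_simps)
  also have "\<dots> = var (i + 1) * f - swap_vars i (var (i + 1) * f)"
    unfolding divdiff_eq by (simp add: algebra_simps swap_vars_mult swap_vars_var)
  finally show "(var i - var (i + 1)) * (var i * divdiff i f - f)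
      = var (i + 1) * f - swap_vars i (var (i + 1) * f)" .
qed

lemma swap_vars_divdiff_commute:
  assumes "i + 1 < j"
  shows "swap_vars i (divdiff j f) = divdiff j (swap_vars i f)"
proof (rule divdiff_unique[symmetric])
  have "(var j - var (j + 1)) * swap_vars i (divdiff j f) = swap_vars i ((var j - var (j + 1)) * divdiff j f)"
    using assms by (simp add: swap_vars_mult swap_vars_diff swap_vars_var transpose_def)
  also have "\<dots> = swap_vars i f - swap_vars j (swap_vars i f)"
    unfolding divdiff_eq by (simp add: swap_vars_diff swap_vars_commute[OF assms])
  finally show "(var j - var (j + 1)) * swap_vars i (divdiff j f) = swap_vars i f - swap_vars j (swap_vars i f)" .
qed

lemma divdiff_diff: "divdiff i (f - g) = divdiff i f - divdiff i g"
  by (rule divdiff_unique) (simp add: right_diff_distrib divdiff_eq[simplified] swap_vars_diff)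

text \<open>The factor \<open>var i - var (i + 1)\<close> is fixed by the distant transposition at
  \<open>j\<close>, so it may be moved inside \<open>divdiff j\<close>.\<close>

lemma divdiff_commute:
  assumes "i + 1 < j"
  shows "divdiff i (divdiff j f) = divdiff j (divdiff i f)"
proof (rule divdiff_unique)
  have sym: "swap_vars j (var i - var (i + 1)) = var i - var (i + 1)"
    using assms by (simp add: swap_vars_diff swap_vars_var transpose_def)
  have "(var i - var (i + 1)) * divdiff j (divdiff i f) = divdiff j (f - swap_vars i f)"
    unfolding divdiff_mult_symmetric[OF sym, symmetric] divdiff_eq ..
  then show "(var i - var (i + 1)) * divdiff j (divdiff i f) = divdiff j f - swap_vars i (divdiff j f)"
    by (simp add: divdiff_diff swap_vars_divdiff_commute[OF assms])
qed

text \<open>Both sides of the braid relation, multiplied by the Vandermonde product, are the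
  alternating sum of \<open>f\<close> over the symmetric group permuting the three variables.\<close>

lemma divdiff_braid:
  "divdiff i (divdiff (i + 1) (divdiff i f)) = divdiff (i + 1) (divdiff i (divdiff (i + 1) f))"
proof -
  define a b c where "a = var i" and "b = var (i + 1)" and "c = var (i + 2)"
  define s t where "s = swap_vars i" and "t = swap_vars (i + 1)"
  define p q where "p = divdiff i" and "q = divdiff (i + 1)"
  have hom: "s (g * h) = s g * s h" "t (g * h) = t g * t h" "s (g - h) = s g - s h"
    "t (g - h) = t g - t h" "s (s g) = g" "t (t g) = g" for g h
    by (simp_all add: s_def t_def swap_vars_mult swap_vars_diff)
  have vars: "s a = b" "s b = a" "s c = c" "t a = a" "t b = c" "t c = b"
    by (simp_all add: s_def t_def a_def b_def c_def swap_vars_var transpose_def)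
  have braid: "s (t (s g)) = t (s (t g))" for g
    using swap_vars_braid[of i g] by (simp add: s_def t_def)
  have p: "(a - b) * p g = g - s g" and q: "(b - c) * q g = g - t g" for g
    using divdiff_eq[of i g] divdiff_eq[of "i + 1" g] by (simp_all add: a_def b_def c_def p_def q_def s_def t_def)
  have inv: "s (p g) = p g" "t (q g) = q g" for g
    by (simp_all add: s_def t_def p_def q_def swap_vars_divdiff[simplified])
  have tp: "(a - c) * t (p g) = t g - t (s g)" for g
    using arg_cong[OF p[of g], of t] by (simp add: hom vars)
  have sq: "(a - c) * s (q g) = s g - s (t g)" for g
    using arg_cong[OF q[of g], of s] by (simp add: hom vars)
  have stp: "(b - c) * s (t (p g)) = s (t g) - s (t (s g))" for g
    using arg_cong[OF tp[of g], of s] by (simp add: hom vars)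
  have tsq: "(a - b) * t (s (q g)) = t (s g) - t (s (t g))" for g
    using arg_cong[OF sq[of g], of t] by (simp add: hom vars)
  have "(a - c) * (b - c) * ((a - b) * p (q (p f)))
      = (a - c) * ((b - c) * q (p f)) - (b - c) * ((a - c) * s (q (p f)))"
    unfolding p by (simp add: algebra_simps)
  also have "\<dots> = (a - b) * p f - (a - c) * t (p f) + (b - c) * s (t (p f))"
    unfolding q sq inv by (simp add: algebra_simps)
  also have "\<dots> = f - s f - t f + t (s f) + s (t f) - s (t (s f))"
    unfolding p tp stp by simp
  finally have 1: "(a - c) * (b - c) * (a - b) * p (q (p f)) = f - s f - t f + t (s f) + s (t f) - s (t (s f))"
    by (simp only: mult.assoc)
  have "(a - c) * (a - b) * ((b - c) * q (p (q f)))
      = (a - c) * ((a - b) * p (q f)) - (a - b) * ((a - c) * t (p (q f)))"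
    unfolding q by (simp add: algebra_simps)
  also have "\<dots> = (b - c) * q f - (a - c) * s (q f) + (a - b) * t (s (q f))"
    unfolding p tp inv by (simp add: algebra_simps)
  also have "\<dots> = f - s f - t f + t (s f) + s (t f) - s (t (s f))"
    unfolding q sq tsq by (simp add: braid)
  finally have 2: "(a - c) * (b - c) * (a - b) * q (p (q f)) = f - s f - t f + t (s f) + s (t f) - s (t (s f))"
    by (simp only: ac_simps)
  have "(a - c) * (b - c) * (a - b) \<noteq> 0"
    by (simp add: a_def b_def c_def var_eq_iff)
  with 1 2 show ?thesis by (metis mult_left_cancel p_def q_def)
qed

section \<open>Well-definedness and cotransition\<close>

lemma permutes_swap_compose:
  fixes n :: nat
  assumes "w permutes {1..n}" "i \<in> {1..n}" "j \<in> {1..n}"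
  shows "(w \<circ> transpose i j) permutes {1..n}"
  using assms by (intro permutes_compose permutes_swap_id) auto

lemma permutes_apply_eq_iff: "w permutes S \<Longrightarrow> w i = w j \<longleftrightarrow> i = j"
  by (metis permutes_inverses(2))

text \<open>An induction measure in place of the length: by the rearrangement inequality it drops
  under every swap that creates an inversion, adjacent or not. It therefore serves both ascents and
  covers.\<close>

definition perm_weight :: "nat \<Rightarrow> (nat \<Rightarrow> nat) \<Rightarrow> nat" where
  "perm_weight n w = (\<Sum>i = 1..n. i * w i)"

lemma perm_weight_swap_less:
  assumes "r \<in> {1..n}" "s \<in> {1..n}" "r < s" "w r < w s"
  shows "perm_weight n (w \<circ> transpose r s) < perm_weight n w"
proof -
  have split: "(\<Sum>i = 1..n. i * v i) = r * v r + (s * v s + (\<Sum>i \<in> {1..n} - {r} - {s}. i * v i))" for v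
    using assms sum.remove[of "{1..n}" r "\<lambda>i. i * v i"] sum.remove[of "{1..n} - {r}" s "\<lambda>i. i * v i"] by simp
  have rest: "(\<Sum>i \<in> {1..n} - {r} - {s}. i * (w \<circ> transpose r s) i) = (\<Sum>i \<in> {1..n} - {r} - {s}. i * w i)"
    by (intro sum.cong) (auto simp: transpose_def)
  \<comment> \<open>The two sums differ by \<open>(s - r) * (w s - w r)\<close>; writing both gaps
    as successors avoids subtraction on \<open>nat\<close>.\<close>
  obtain d e where "s = r + Suc d" "w s = w r + Suc e"
    using assms(3,4) by (metis less_imp_Suc_add add_Suc_right)
  then have "r * w s + s * w r < r * w r + s * w s" by (simp add: algebra_simps)
  then show ?thesis unfolding perm_weight_def split rest by simp
qed

text \<open>Strict decrease squeezes each value: from the left it starts at most at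
  \<open>n\<close>, and from the right it ends at least at 1.\<close>

lemma no_ascent_imp_longest:
  assumes w: "w permutes {1..n}" and noasc: "\<And>i. i \<in> {1..<n} \<Longrightarrow> \<not> w i < w (i + 1)"
  shows "w = longest_perm n"
proof -
  have desc: "w (i + 1) < w i" if "i \<in> {1..<n}" for i
    using noasc[OF that] permutes_apply_eq_iff[OF w, of i "i + 1"] by simp
  have up: "w i \<le> n + 1 - i" if "1 \<le> i" "i \<le> n" for i
    using that
  proof (induction i rule: dec_induct)
    case base
    then show ?case using permutes_in_image[OF w, of 1] by simp
  next
    case (step i)
    then show ?case using desc[of i] by simp
  qed
  have low: "n + 1 - i \<le> w i" if "i \<le> n" "1 \<le> i" for i
    using that
  proof (induction i rule: inc_induct)
    case base
    then show ?case using permutes_in_image[OF w, of n] by simp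
  next
    case (step i)
    then show ?case using desc[of i] by simp
  qed
  show ?thesis
  proof
    fix i
    show "w i = longest_perm n i"
      using up[of i] low[of i] permutes_not_in[OF w, of i] by (auto simp: longest_perm_def)
  qed
qed

lemma longest_perm_permutes: "longest_perm n permutes {1..n}"
proof (rule bij_imp_permutes)
  show "bij_betw (longest_perm n) {1..n} {1..n}"
    by (rule bij_betw_byWitness[where f' = "longest_perm n"]) (auto simp: longest_perm_def)
qed (auto simp: longest_perm_def)

lemma schubert_rel_permutes: "schubert_rel n w f \<Longrightarrow> w permutes {1..n}"
  by (induction rule: schubert_rel.induct) (rule longest_perm_permutes | assumption)+

lemma ex_schubert_rel:
  assumes "w permutes {1..n}"
  shows "\<exists>f. schubert_rel n w f"
  using assms
proof (induction "perm_weight n w" arbitrary: w rule: less_induct)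
  case less
  show ?case
  proof (cases "w = longest_perm n")
    case True
    then show ?thesis using schubert_rel.longest by blast
  next
    case False
    then obtain i where i: "i \<in> {1..<n}" "w i < w (i + 1)"
      using no_ascent_imp_longest[OF less.prems] by blast
    then have "\<exists>f. schubert_rel n (w \<circ> transpose i (i + 1)) f"
      using less.prems by (intro less.hyps perm_weight_swap_less permutes_swap_compose) auto
    then show ?thesis using schubert_rel.ascent[OF less.prems i] by blast
  qed
qed

lemma schubert_rel_longest_only:
  assumes "schubert_rel n (longest_perm n) f"
  shows "f = (\<Prod>i = 1..n. var i ^ (n - i))"
  using assms by (cases rule: schubert_rel.cases) (auto simp: longest_perm_def)

text \<open>Diamond argument: two ascents \<open>i\<close>, \<open>j\<close> of \<open>w\<close> are joined above \<open>w\<close> by a commutation or a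
  braid relation.\<close>

lemma schubert_rel_unique:
  assumes "schubert_rel n w f" "schubert_rel n w g"
  shows "f = g"
  using assms
proof (induction "perm_weight n w" arbitrary: w f g rule: less_induct)
  case less
  have w: "w permutes {1..n}" using less.prems(1) by (rule schubert_rel_permutes)
  show ?case
  proof (cases "w = longest_perm n")
    case True
    then show ?thesis using less.prems schubert_rel_longest_only by metis
  next
    case False
    have step: "f' = g'" if "schubert_rel n (w \<circ> transpose i (i + 1)) f'" "schubert_rel n (w \<circ> transpose i (i + 1)) g'"
      "i \<in> {1..<n}" "w i < w (i + 1)" for i f' g'
      using that by (intro less.hyps[of "w \<circ> transpose i (i + 1)"] perm_weight_swap_less) auto
    have diamond: "divdiff i f' = divdiff j g'"
      if i: "i \<in> {1..<n}" "w i < w (i + 1)" "schubert_rel n (w \<circ> transpose i (i + 1)) f'"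
        and j: "j \<in> {1..<n}" "w j < w (j + 1)" "schubert_rel n (w \<circ> transpose j (j + 1)) g'"
        and "i < j" for i j f' g'
    proof (cases "j = i + 1")
      case False
      with \<open>i < j\<close> have ij: "i + 1 < j" by simp
      let ?v = "w \<circ> transpose i (i + 1) \<circ> transpose j (j + 1)"
      have v: "w \<circ> transpose j (j + 1) \<circ> transpose i (i + 1) = ?v"
        using ij by (auto simp: fun_eq_iff transpose_def)
      have pi: "(w \<circ> transpose i (i + 1)) permutes {1..n}" and pj: "(w \<circ> transpose j (j + 1)) permutes {1..n}"
        using i(1) j(1) by - (rule permutes_swap_compose[OF w]; simp)+
      \<comment> \<open>Any polynomial \<open>h\<close> of the common upper permutation yields,
        along the two sides of the diamond, polynomials for the two neighbours of \<open>w\<close>.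
        The induction hypothesis identifies these with \<open>f'\<close> and
        \<open>g'\<close>.\<close>
      have "?v permutes {1..n}" using j(1) by (intro permutes_swap_compose[OF pi]) auto
      then obtain h where h: "schubert_rel n ?v h" using ex_schubert_rel by blast
      have "schubert_rel n (w \<circ> transpose i (i + 1)) (divdiff j h)"
        using ij j h by (intro schubert_rel.ascent[OF pi]) (auto simp: transpose_def)
      then have "f' = divdiff j h" using i step by blast
      moreover have "schubert_rel n (w \<circ> transpose j (j + 1)) (divdiff i h)"
        using ij i h v by (intro schubert_rel.ascent[OF pj]) (auto simp: transpose_def)
      then have "g' = divdiff i h" using j step by blast
      ultimately show ?thesis by (simp add: divdiff_commute[OF ij])
    next
      case True
      let ?s = "transpose i (i + 1)" and ?t = "transpose (i + 1) (i + 1 + 1)"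
      let ?v = "w \<circ> ?s \<circ> ?t \<circ> ?s"
      have v: "w \<circ> ?t \<circ> ?s \<circ> ?t = ?v"
        by (auto simp: fun_eq_iff transpose_def)
      have mem: "i \<in> {1..n}" "i + 1 \<in> {1..n}" "i + 1 + 1 \<in> {1..n}" "i + 1 \<in> {1..<n}"
        using i(1) j(1) True by auto
      have ps: "(w \<circ> ?s) permutes {1..n}" and pt: "(w \<circ> ?t) permutes {1..n}"
        by (rule permutes_swap_compose[OF w]; fact mem)+
      have pst: "(w \<circ> ?s \<circ> ?t) permutes {1..n}" and pts: "(w \<circ> ?t \<circ> ?s) permutes {1..n}"
        by (rule permutes_swap_compose[OF ps] permutes_swap_compose[OF pt]; fact mem)+
      have "?v permutes {1..n}" by (rule permutes_swap_compose[OF pst]; fact mem)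
      then obtain h where h: "schubert_rel n ?v h" using ex_schubert_rel by blast
      have asc: "w i < w (i + 1)" "w (i + 1) < w (i + 1 + 1)" using i j True by simp_all
      have "schubert_rel n (w \<circ> ?s \<circ> ?t) (divdiff i h)"
        using asc h by (intro schubert_rel.ascent[OF pst i(1)]) (auto simp: transpose_def)
      then have "schubert_rel n (w \<circ> ?s) (divdiff (i + 1) (divdiff i h))"
        using asc by (intro schubert_rel.ascent[OF ps mem(4)]) (auto simp: transpose_def)
      then have "f' = divdiff (i + 1) (divdiff i h)" using i step by blast
      moreover have "schubert_rel n (w \<circ> ?t \<circ> ?s) (divdiff (i + 1) h)"
        using asc h v by (intro schubert_rel.ascent[OF pts mem(4)]) (auto simp: transpose_def)
      then have "schubert_rel n (w \<circ> ?t) (divdiff i (divdiff (i + 1) h))"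
        using asc by (intro schubert_rel.ascent[OF pt i(1)]) (auto simp: transpose_def)
      then have "g' = divdiff i (divdiff (i + 1) h)" using j step True by blast
      ultimately show ?thesis by (simp only: divdiff_braid True)
    qed
    obtain i f' where i: "i \<in> {1..<n}" "w i < w (i + 1)" "schubert_rel n (w \<circ> transpose i (i + 1)) f'" "f = divdiff i f'"
      using less.prems(1) False by (cases rule: schubert_rel.cases) auto
    obtain j g' where j: "j \<in> {1..<n}" "w j < w (j + 1)" "schubert_rel n (w \<circ> transpose j (j + 1)) g'" "g = divdiff j g'"
      using less.prems(2) False by (cases rule: schubert_rel.cases) auto
    consider "i < j" | "j < i" | "i = j" by linarith
    then show ?thesis
    proof cases
      case 1
      then show ?thesis using diamond i j by blast
    next
      case 2
      then show ?thesis using diamond i j by metis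
    next
      case 3
      then show ?thesis using step i j by metis
    qed
  qed
qed

section \<open>Schubert polynomials under divided differences, and the cotransition formula\<close>

lemma schubert_eqI: "schubert_rel n w f \<Longrightarrow> schubert n w = f"
  unfolding schubert_def by (rule the_equality) (auto intro: schubert_rel_unique)

lemma schubert_rel_schubert: "w permutes {1..n} \<Longrightarrow> schubert_rel n w (schubert n w)"
  using ex_schubert_rel schubert_eqI by metis

lemma schubert_longest: "schubert n (longest_perm n) = (\<Prod>i = 1..n. var i ^ (n - i))"
  by (rule schubert_eqI[OF schubert_rel.longest])

lemma schubert_ascent:
  assumes "w permutes {1..n}" "i \<in> {1..<n}" "w i < w (i + 1)"
  shows "schubert n w = divdiff i (schubert n (w \<circ> transpose i (i + 1)))"
  using assms by (intro schubert_eqI schubert_rel.ascent schubert_rel_schubert permutes_swap_compose) auto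

lemma divdiff_schubert_ascent:
  assumes "w permutes {1..n}" "i \<in> {1..<n}" "w i < w (i + 1)"
  shows "divdiff i (schubert n w) = 0"
  unfolding schubert_ascent[OF assms] by (rule divdiff_symmetric) (rule swap_vars_divdiff)

lemma divdiff_schubert_descent:
  assumes "w permutes {1..n}" "i \<in> {1..<n}" "w (i + 1) < w i"
  shows "divdiff i (schubert n w) = schubert n (w \<circ> transpose i (i + 1))"
proof -
  have "schubert n (w \<circ> transpose i (i + 1))
      = divdiff i (schubert n (w \<circ> transpose i (i + 1) \<circ> transpose i (i + 1)))"
    using assms by (intro schubert_ascent permutes_swap_compose) auto
  then show ?thesis by (simp add: o_assoc[symmetric])
qed

text \<open>Covers in the Bruhat order: with no intermediate value at an intermediate position,
  \<open>w \<circ> transpose r s\<close> has exactly one inversion more than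
  \<open>w\<close>.\<close>

definition covers :: "nat \<Rightarrow> (nat \<Rightarrow> nat) \<Rightarrow> nat \<Rightarrow> nat set" where
  "covers n w r = {s \<in> {r<..n}. w r < w s \<and> (\<forall>q \<in> {r<..<s}. \<not> (w r < w q \<and> w q < w s))}"

lemma finite_covers [simp]: "finite (covers n w r)"
  by (rule finite_subset[of _ "{..n}"]) (auto simp: covers_def)

text \<open>Matches the summands that survive \<open>divdiff i\<close>. The descent condition is
  automatic unless \<open>s = i + 1\<close>. In that case \<open>t s = i\<close>, so position
  \<open>i\<close> lies between \<open>r\<close> and \<open>s\<close> but no longer between
  \<open>r\<close> and \<open>t s\<close>; the descent condition then says \<open>w i < w r\<close>,
  which is exactly that position \<open>i\<close> does not block the cover of
  \<open>w\<close>.\<close>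

lemma covers_swap_iff:
  assumes w: "w permutes {1..n}" and i: "i \<in> {r<..<n}" "w i < w (i + 1)"
  defines "t \<equiv> transpose i (i + 1)"
  shows "t s \<in> covers n (w \<circ> t) r \<and> (w \<circ> t \<circ> transpose r (t s)) (i + 1) < (w \<circ> t \<circ> transpose r (t s)) i
    \<longleftrightarrow> s \<in> covers n w r"
proof -
  have wr: "w (t r) = w r" using i by (simp add: t_def transpose_def)
  have ne: "w i \<noteq> w r" using permutes_apply_eq_iff[OF w] i by simp
  consider "s = i" | "s = i + 1" | "s \<noteq> i" "s \<noteq> i + 1" by blast
  then show ?thesis
  proof cases
    case 1
    have int: "{r<..<i + 1} = insert i {r<..<i}" using i by auto
    have same: "w (t q) = w q" if "q \<in> {r<..<i}" for q using that by (simp add: t_def transpose_def)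
    show ?thesis using 1 i wr same by (auto simp: covers_def int t_def simp del: One_nat_def add_Suc_right; simp add: transpose_def)
  next
    case 2
    have int: "{r<..<i + 1} = insert i {r<..<i}" using i by auto
    have same: "w (t q) = w q" if "q \<in> {r<..<i}" for q using that by (simp add: t_def transpose_def)
    show ?thesis using 2 i wr same ne by (auto simp: covers_def int t_def simp del: One_nat_def add_Suc_right; simp add: transpose_def)
  next
    case 3
    have ts: "t s = s" using 3 by (simp add: t_def transpose_def)
    have mem: "t q \<in> {r<..<s} \<longleftrightarrow> q \<in> {r<..<s}" for q using 3 i by (auto simp: t_def transpose_def)
    have tt: "t (t q) = q" for q by (simp add: t_def)
    have "(\<forall>q \<in> {r<..<s}. \<not> (w r < w (t q) \<and> w (t q) < w s)) \<longleftrightarrow> (\<forall>q \<in> {r<..<s}. \<not> (w r < w q \<and> w q < w s))"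
      by (metis mem tt)
    moreover have "(w \<circ> t \<circ> transpose r s) (i + 1) < (w \<circ> t \<circ> transpose r s) i"
      using 3 i by (simp add: t_def transpose_def)
    ultimately show ?thesis by (simp add: covers_def ts wr)
  qed
qed

text \<open>Pigeonhole: the values above \<open>n + 1 - r\<close> are used up by the rows before
  \<open>r\<close>.\<close>

lemma perm_le_of_prefix:
  fixes n :: nat
  assumes w: "w permutes {1..n}" and pre: "\<forall>q \<in> {1..<r}. w q = n + 1 - q" and s: "r \<le> s" "s \<in> {1..n}"
  shows "w s \<le> n + 1 - r"
proof (rule ccontr)
  assume a: "\<not> w s \<le> n + 1 - r"
  have le: "1 \<le> w s" "w s \<le> n" using permutes_in_image[OF w, of s] s by auto
  have "n + 1 < w s + r" using a s by auto
  then have "n + 1 - w s \<in> {1..<r}" using le by auto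
  then have "w (n + 1 - w s) = w s" using bspec[OF pre] le by fastforce
  then show False using permutes_apply_eq_iff[OF w] a s le by auto
qed

text \<open>The staircase monomial is \<open>var r\<close> times a monomial symmetric in the
  variables \<open>r\<close> and \<open>r + 1\<close>, so \<open>divdiff r\<close> removes exactly
  one factor \<open>var r\<close>.\<close>

lemma var_mult_divdiff_staircase:
  assumes "r \<in> {1..<n}"
  shows "var r * divdiff r (\<Prod>i = 1..n. var i ^ (n - i)) = (\<Prod>i = 1..n. var i ^ (n - i))"
proof -
  define M where "M = (\<Prod>i \<in> {1..n} - {r} - {r + 1}. var i ^ (n - i))"
  define Q where "Q = (var r * var (r + 1)) ^ (n - (r + 1)) * M"
  have "swap_vars r M = M" unfolding M_def swap_vars_prod
    by (intro prod.cong) (auto simp: swap_vars_power swap_vars_var transpose_def)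
  then have Q: "swap_vars r Q = Q"
    by (simp add: Q_def swap_vars_mult swap_vars_power swap_vars_var mult.commute)
  have "(\<Prod>i = 1..n. var i ^ (n - i)) = var r ^ (n - r) * (var (r + 1) ^ (n - (r + 1)) * M)"
    using assms prod.remove[of "{1..n}" r "\<lambda>i. var i ^ (n - i)"]
      prod.remove[of "{1..n} - {r}" "r + 1" "\<lambda>i. var i ^ (n - i)"] by (simp add: M_def)
  moreover have "n - r = Suc (n - (r + 1))" using assms[unfolded atLeastLessThan_iff] by linarith
  ultimately have eq: "(\<Prod>i = 1..n. var i ^ (n - i)) = Q * var r"
    by (simp only: Q_def power_Suc power_mult_distrib ac_simps)
  have "divdiff r (var r) = 1" by (rule divdiff_unique) (simp add: swap_vars_var)
  then show ?thesis unfolding eq divdiff_mult_symmetric[OF Q] by (simp add: mult.commute)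
qed

text \<open>A cotransition formula, that is, Monk's rule for a row without negative terms. Descending
  from the longest element, a divided difference at a position beyond \<open>r\<close> preserves the
  formula, and one at \<open>r\<close> turns the formula for \<open>r + 1\<close> into the one for \<open>r\<close>.\<close>

lemma cotransition:
  assumes "w permutes {1..n}" "1 \<le> r" "\<forall>q \<in> {1..<r}. w q = n + 1 - q" "w r < n + 1 - r"
  shows "var r * schubert n w = (\<Sum>s \<in> covers n w r. schubert n (w \<circ> transpose r s))"
  using assms
proof (induction "perm_weight n w" arbitrary: w r rule: less_induct)
  case less
  note w = less.prems(1)
  have "r \<in> {1..n}" using less.prems(2,4) by simp
  then have "1 \<le> w r" using permutes_in_image[OF w, of r] by simp
  then have "r < n" using less.prems(4) by linarith
  show ?case
  proof (cases "\<exists>i \<in> {r<..<n}. w i < w (i + 1)")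
    case True
    then obtain i where i: "i \<in> {r<..<n}" "w i < w (i + 1)" by blast
    define t where "t = transpose i (i + 1)"
    define u where "u = w \<circ> t"
    have tt [simp]: "t (t q) = q" for q by (simp add: t_def)
    have i': "i \<in> {1..<n}" using i by auto
    have u: "u permutes {1..n}" unfolding u_def t_def using i' by (intro permutes_swap_compose[OF w]) auto
    have "var r * schubert n w = divdiff i (var r * schubert n u)"
      using i by (simp add: schubert_ascent[OF w i' i(2)] u_def t_def divdiff_mult_symmetric swap_vars_var)
    also have "var r * schubert n u = (\<Sum>s \<in> covers n u r. schubert n (u \<circ> transpose r s))"
      using less.prems i i' u unfolding u_def t_def
      by (intro less.hyps perm_weight_swap_less) (auto simp: transpose_def)
    also have "divdiff i \<dots> = (\<Sum>s \<in> covers n u r. divdiff i (schubert n (u \<circ> transpose r s)))"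
      by (rule divdiff_sum)
    \<comment> \<open>A summand with an ascent at \<open>i\<close> is symmetric in the variables
      \<open>i\<close> and \<open>i + 1\<close>, so its divided difference vanishes.\<close>
    also have "\<dots> = (\<Sum>s \<in> {s \<in> covers n u r. (u \<circ> transpose r s) (i + 1) < (u \<circ> transpose r s) i}.
        divdiff i (schubert n (u \<circ> transpose r s)))"
    proof (intro sum.mono_neutral_right ballI)
      fix s assume s: "s \<in> covers n u r - {s \<in> covers n u r. (u \<circ> transpose r s) (i + 1) < (u \<circ> transpose r s) i}"
      then have p: "(u \<circ> transpose r s) permutes {1..n}"
        using less.prems \<open>r < n\<close> by (intro permutes_swap_compose[OF u]) (auto simp: covers_def)
      then have "(u \<circ> transpose r s) i \<noteq> (u \<circ> transpose r s) (i + 1)"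
        using permutes_apply_eq_iff by fastforce
      then show "divdiff i (schubert n (u \<circ> transpose r s)) = 0"
        using s by (intro divdiff_schubert_ascent[OF p i']) auto
    qed auto
    also have "\<dots> = (\<Sum>s \<in> covers n w r. schubert n (w \<circ> transpose r s))"
    proof (rule sum.reindex_bij_witness[where i = t and j = t])
      fix s assume s: "s \<in> {s \<in> covers n u r. (u \<circ> transpose r s) (i + 1) < (u \<circ> transpose r s) i}"
      show "t s \<in> covers n w r"
        using s covers_swap_iff[OF w i, of "t s", folded t_def] by (simp add: u_def)
      have p: "(u \<circ> transpose r s) permutes {1..n}"
        using s less.prems \<open>r < n\<close> by (intro permutes_swap_compose[OF u]) (auto simp: covers_def)
      have "u \<circ> transpose r s \<circ> transpose i (i + 1) = w \<circ> transpose r (t s)"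
        using i by (auto simp: u_def t_def fun_eq_iff transpose_def)
      then show "schubert n (w \<circ> transpose r (t s)) = divdiff i (schubert n (u \<circ> transpose r s))"
        using s by (simp add: divdiff_schubert_descent[OF p i'])
    next
      fix s assume s: "s \<in> covers n w r"
      then show "t s \<in> {s \<in> covers n u r. (u \<circ> transpose r s) (i + 1) < (u \<circ> transpose r s) i}"
        using covers_swap_iff[OF w i, of s, folded t_def] by (simp add: u_def)
    qed simp_all
    finally show ?thesis .
  next
    case False
    have inj: "w i = w j \<longleftrightarrow> i = j" for i j by (rule permutes_apply_eq_iff[OF w])
    have dec: "w j < w i" if "i < j" "r < i" "j \<le> n" for i j
      using that
    proof (induction j rule: less_induct)
      case (less j)
      have step: "w j < w (j - 1)"
      proof -
        have "Suc (j - 1) = j" "j - 1 \<in> {r<..<n}" using less.prems by auto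
        then have "\<not> w (j - 1) < w j" using False by (metis Suc_eq_plus1)
        moreover have "j \<noteq> j - 1" using less.prems by simp
        ultimately show ?thesis using inj[of j "j - 1"] by linarith
      qed
      show ?case
      proof (cases "i = j - 1")
        case True
        then show ?thesis using step by simp
      next
        case False
        then have "w (j - 1) < w i" using less.prems by (intro less.IH) auto
        then show ?thesis using step by simp
      qed
    qed
    have le: "w s \<le> n + 1 - r" if "r \<le> s" "s \<le> n" for s
      using perm_le_of_prefix[OF w less.prems(3), of s] that less.prems(2) by simp
    \<comment> \<open>The largest value that the first \<open>r - 1\<close> rows leave over is not
      in row \<open>r\<close>, so it heads the decreasing tail.\<close>
    have top: "w (r + 1) = n + 1 - r"
    proof -
      define p where "p = inv w (n + 1 - r)"
      have wp: "w p = n + 1 - r" by (simp add: p_def permutes_inverses[OF w])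
      then have pn: "p \<in> {1..n}" using permutes_in_image[OF w, of p] \<open>r \<in> {1..n}\<close> by auto
      have "p \<noteq> r" using wp less.prems(4) by auto
      moreover have "\<not> p < r" using wp pn less.prems(3) \<open>r < n\<close> by auto
      ultimately have "r + 1 \<le> p" by simp
      moreover have "\<not> r + 1 < p" using dec[of "r + 1" p] wp pn le[of "r + 1"] by auto
      ultimately show ?thesis using wp by simp
    qed
    define t where "t = transpose r (r + 1)"
    define u where "u = w \<circ> t"
    have r': "r \<in> {1..<n}" using less.prems \<open>r < n\<close> by simp
    have asc: "w r < w (r + 1)" using top less.prems(4) by simp
    have u: "u permutes {1..n}" unfolding u_def t_def using r' by (intro permutes_swap_compose[OF w]) auto
    have Sw: "schubert n w = divdiff r (schubert n u)"
      unfolding u_def t_def by (rule schubert_ascent[OF w r' asc])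
    have ur: "u r = n + 1 - r" "u (r + 1) = w r" using top by (simp_all add: u_def t_def)
    have uo: "u q = w q" if "q \<noteq> r" "q \<noteq> r + 1" for q using that by (simp add: u_def t_def transpose_def)
    show ?thesis
    proof (cases "w r = n - r")
      case True
      \<comment> \<open>Now row \<open>r + 1\<close> of \<open>u\<close> also has its maximal value,
        so the formula for \<open>r + 1\<close> does not apply to \<open>u\<close>. But then
        \<open>u\<close> is the longest permutation, and everything is explicit.\<close>
      have "u = longest_perm n"
      proof (rule no_ascent_imp_longest[OF u])
        fix i assume i: "i \<in> {1..<n}"
        consider "i + 1 < r" | "i + 1 = r" | "i = r" | "i = r + 1" | "r + 1 < i" by linarith
        then show "\<not> u i < u (i + 1)"
        proof cases
          case 1
          then show ?thesis using less.prems(3) i uo by simp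
        next
          case 2
          then have "u i = n + 1 - i" using less.prems(3) i uo[of i] by simp
          then show ?thesis using 2 ur i by (auto simp: 2)
        next
          case 3
          then show ?thesis using ur True by simp
        next
          case 4
          then have "w (i + 1) \<noteq> w (r + 1)" using inj by simp
          then show ?thesis using ur(2) uo[of "i + 1"] le[of "i + 1"] i True 4 top by simp
        next
          case 5
          then show ?thesis using uo[of i] uo[of "i + 1"] dec[of i "i + 1"] i by simp
        qed
      qed
      then have "var r * schubert n w = schubert n u"
        unfolding Sw by (simp only: schubert_longest var_mult_divdiff_staircase[OF r'])
      moreover have "covers n w r = {r + 1}"
      proof -
        have "s = r + 1" if "s \<in> covers n w r" for s
          using that le[of s] True top inj[of s "r + 1"] \<open>r < n\<close> by (simp add: covers_def Suc_diff_le)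
        moreover have "r + 1 \<in> covers n w r" using asc \<open>r < n\<close> by (simp add: covers_def)
        ultimately show ?thesis by blast
      qed
      ultimately show ?thesis by (simp add: u_def t_def)
    next
      case False
      have lt: "w r < n - r" using False less.prems(4) \<open>r < n\<close> by simp
      have pre: "\<forall>q \<in> {1..<r + 1}. u q = n + 1 - q"
        using less.prems(3) ur(1) uo by (auto simp: less_Suc_eq)
      have IH: "var (r + 1) * schubert n u = (\<Sum>s \<in> covers n u (r + 1). schubert n (u \<circ> transpose (r + 1) s))"
      proof (rule less.hyps[OF _ u _ pre])
        show "perm_weight n u < perm_weight n w"
          unfolding u_def t_def using r' asc by (intro perm_weight_swap_less) auto
      qed (use lt ur in auto)
      \<comment> \<open>Position \<open>r + 1\<close> is itself a cover of \<open>w\<close>. It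
        blocks no later one, since its value is the largest among the rows from \<open>r\<close>
        on.\<close>
      have cov: "covers n w r = insert (r + 1) (covers n u (r + 1))"
      proof -
        have "s \<in> covers n w r \<longleftrightarrow> s \<in> covers n u (r + 1)" if "r + 1 < s" for s
        proof -
          have int: "{r<..<s} = insert (r + 1) {r + 1<..<s}" using that by auto
          show ?thesis using that le[of s] uo ur top
            by (auto simp: covers_def int)
        qed
        moreover have "r + 1 \<in> covers n w r" using asc \<open>r < n\<close> by (simp add: covers_def)
        moreover have "s \<notin> covers n w r" "s \<notin> covers n u (r + 1)" if "s \<le> r" for s
          using that by (simp_all add: covers_def)
        moreover have "r + 1 \<notin> covers n u (r + 1)" by (simp add: covers_def)
        moreover have "s \<le> r \<or> s = r + 1 \<or> r + 1 < s" for s by linarith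
        ultimately show ?thesis by blast
      qed
      \<comment> \<open>The first summand belongs to the cover \<open>s = r + 1\<close>, because
        \<open>u\<close> is \<open>w\<close> with rows \<open>r\<close> and \<open>r + 1\<close>
        swapped.\<close>
      have "var r * schubert n w = schubert n u + divdiff r (var (r + 1) * schubert n u)"
        using divdiff_var_mult[of r "schubert n u"] by (simp add: Sw)
      also have "divdiff r (var (r + 1) * schubert n u)
          = (\<Sum>s \<in> covers n u (r + 1). divdiff r (schubert n (u \<circ> transpose (r + 1) s)))"
        unfolding IH by (rule divdiff_sum)
      also have "\<dots> = (\<Sum>s \<in> covers n u (r + 1). schubert n (w \<circ> transpose r s))"
      proof (rule sum.cong[OF refl])
        fix s assume s: "s \<in> covers n u (r + 1)"
        have p: "(u \<circ> transpose (r + 1) s) permutes {1..n}"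
          using s r' by (intro permutes_swap_compose[OF u]) (auto simp: covers_def)
        have "u s < n + 1 - r"
          using s uo[of s] le[of s] top inj[of s "r + 1"] by (auto simp: covers_def)
        then have "(u \<circ> transpose (r + 1) s) (r + 1) < (u \<circ> transpose (r + 1) s) r"
          using s ur by (simp add: covers_def transpose_def)
        then have "divdiff r (schubert n (u \<circ> transpose (r + 1) s))
            = schubert n (u \<circ> transpose (r + 1) s \<circ> transpose r (r + 1))"
          by (rule divdiff_schubert_descent[OF p r'])
        also have "u \<circ> transpose (r + 1) s \<circ> transpose r (r + 1) = w \<circ> transpose r s"
          using s by (auto simp: u_def t_def fun_eq_iff transpose_def covers_def)
        finally show "divdiff r (schubert n (u \<circ> transpose (r + 1) s)) = schubert n (w \<circ> transpose r s)" .
      qed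
      finally have "var r * schubert n w
          = schubert n (w \<circ> transpose r (r + 1)) + (\<Sum>s \<in> covers n u (r + 1). schubert n (w \<circ> transpose r s))"
        by (simp only: u_def t_def)
      moreover have "r + 1 \<notin> covers n u (r + 1)" by (simp add: covers_def)
      ultimately show ?thesis unfolding cov by (simp only: sum.insert finite_covers not_False_eq_True)
    qed
  qed
qed

section \<open>Column sets in componentwise order\<close>

text \<open>The componentwise (Gale) order on sets of equal size. Prefix counts are used in place of
  sorted lists because they behave additively under inserting, deleting and splicing.\<close>

definition below :: "nat set \<Rightarrow> nat set set" where
  "below D = {E. finite E \<and> 0 \<notin> E \<and> card E = card D \<and> (\<forall>k. card (D \<inter> {..k}) \<le> card (E \<inter> {..k}))}"

lemma below_trans: "E \<in> below D' \<Longrightarrow> D' \<in> below D \<Longrightarrow> E \<in> below D"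
  unfolding below_def mem_Collect_eq by (metis order_trans)

lemma below_pos: "E \<in> below D \<Longrightarrow> x \<in> E \<Longrightarrow> 1 \<le> x"
  by (cases x) (auto simp: below_def)

lemma below_subset:
  assumes "E \<in> below D" "D \<subseteq> {1..n}"
  shows "E \<subseteq> {1..n}"
proof -
  have "D \<inter> {..n} = D" using assms(2) by auto
  moreover have "card (D \<inter> {..n}) \<le> card (E \<inter> {..n})" "card E = card D"
    using assms(1) by (simp_all add: below_def)
  ultimately have "card E \<le> card (E \<inter> {..n})" by simp
  then have "E \<inter> {..n} = E" using assms(1) by (intro card_seteq) (auto simp: below_def)
  then show ?thesis using below_pos[OF assms(1)] by auto
qed

text \<open>If the rows \<open>1..<r\<close> all belong to \<open>D\<close>, then \<open>E\<close>
  needs \<open>r - 1\<close> elements among the \<open>r - 1\<close> positive numbers below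
  \<open>r\<close>.\<close>

lemma below_prefix:
  assumes "E \<in> below D" "{1..<r} \<subseteq> D"
  shows "{1..<r} \<subseteq> E"
proof (cases r)
  case (Suc k)
  have "card {1..k} \<le> card (D \<inter> {..k})" using assms(2) Suc by (intro card_mono) auto
  also have "\<dots> \<le> card (E \<inter> {..k})" using assms(1) by (simp add: below_def)
  finally have "card {1..k} \<le> card (E \<inter> {..k})" .
  moreover have "E \<inter> {..k} \<subseteq> {1..k}" using below_pos[OF assms(1)] by auto
  ultimately have "E \<inter> {..k} = {1..k}" by (intro card_seteq) auto
  then have "{1..k} \<subseteq> E" by blast
  then show ?thesis using Suc by (simp add: atLeastLessThanSuc_atLeastAtMost)
qed simp

lemma below_initial: "E \<in> below {1..<r} \<longleftrightarrow> E = {1..<r}"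
proof
  assume E: "E \<in> below {1..<r}"
  then have "{1..<r} \<subseteq> E" by (rule below_prefix) simp
  moreover have "finite E" "card {1..<r} = card E" using E by (simp_all add: below_def)
  ultimately show "E = {1..<r}" by (metis card_subset_eq)
qed (simp add: below_def)

section \<open>Inserting, deleting and moving a single element\<close>

lemma card_insert_Int_atMost:
  fixes E :: "nat set"
  shows "r \<notin> E \<Longrightarrow> card (insert r E \<inter> {..k}) = card (E \<inter> {..k}) + (if r \<le> k then 1 else 0)"
  by (simp add: card_insert_if)

lemma below_insert:
  assumes "E \<in> below D" "r \<notin> D" "r \<notin> E" "0 < r" "finite D"
  shows "insert r E \<in> below (insert r D)"
  using assms by (auto simp: below_def card_insert_Int_atMost simp del: Int_insert_left)

lemma below_remove:
  assumes "E \<in> below (insert r D)" "r \<notin> D" "r \<in> E" "finite D"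
  shows "E - {r} \<in> below D"
proof -
  have "E = insert r (E - {r})" using assms(3) by blast
  then have E: "insert r (E - {r}) \<in> below (insert r D)" using assms(1) by simp
  then have "card ((E - {r}) \<inter> {..k}) \<ge> card (D \<inter> {..k})" for k
    using card_insert_Int_atMost[of r "E - {r}" k] card_insert_Int_atMost[OF assms(2), of k]
    by (simp add: below_def del: Int_insert_left insert_Diff_single) (metis add_le_cancel_right)
  then show ?thesis using assms by (auto simp: below_def)
qed

text \<open>Moving the element \<open>s\<close> of \<open>D\<close> down to \<open>r\<close> raises
  its prefix counts by one exactly for \<open>r \<le> k < s\<close>; \<open>slack\<close> provides
  for this.\<close>

lemma below_replace:
  assumes E: "E \<in> below D" and D: "s \<in> D" "r \<notin> D" "finite D" and "r < s"
    and slack: "\<And>k. r \<le> k \<Longrightarrow> k < s \<Longrightarrow> card (D \<inter> {..k}) < card (E \<inter> {..k})"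
  shows "E \<in> below (insert r (D - {s}))"
proof -
  have "card (insert r (D - {s}) \<inter> {..k}) \<le> card (E \<inter> {..k})" for k
  proof -
    have "D = insert s (D - {s})" using D(1) by blast
    then have "card (D \<inter> {..k}) = card ((D - {s}) \<inter> {..k}) + (if s \<le> k then 1 else 0)"
      using card_insert_Int_atMost[of s "D - {s}" k] by simp
    moreover have "card (insert r (D - {s}) \<inter> {..k}) = card ((D - {s}) \<inter> {..k}) + (if r \<le> k then 1 else 0)"
      using D(2) by (intro card_insert_Int_atMost) simp
    moreover have "card (D \<inter> {..k}) \<le> card (E \<inter> {..k})" using E by (simp add: below_def)
    ultimately show ?thesis using slack[of k] \<open>r < s\<close> by (auto split: if_splits)
  qed
  moreover have "card (insert r (D - {s})) = card D"
    using D card_Suc_Diff1[of D s] by (simp add: card_insert_if)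
  ultimately show ?thesis using E by (simp add: below_def)
qed

lemma below_insert_remove:
  assumes D: "s \<in> D" "r \<notin> D" "finite D" "0 \<notin> D" and "0 < r" "r < s"
  shows "insert r (D - {s}) \<in> below D"
proof -
  have "card (D \<inter> {..k}) \<le> card (insert r (D - {s}) \<inter> {..k})" for k
  proof -
    have "D = insert s (D - {s})" using D(1) by blast
    then have "card (D \<inter> {..k}) = card ((D - {s}) \<inter> {..k}) + (if s \<le> k then 1 else 0)"
      using card_insert_Int_atMost[of s "D - {s}" k] by simp
    moreover have "card (insert r (D - {s}) \<inter> {..k}) = card ((D - {s}) \<inter> {..k}) + (if r \<le> k then 1 else 0)"
      using D(2) by (intro card_insert_Int_atMost) simp
    ultimately show ?thesis using \<open>r < s\<close> by simp
  qed
  moreover have "card (insert r (D - {s})) = card D"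
    using D card_Suc_Diff1[of D s] by (simp add: card_insert_if)
  ultimately show ?thesis using assms by (simp add: below_def)
qed

text \<open>Up to \<open>m\<close> the new set is compared as \<open>E2\<close> is with
  \<open>D2\<close>, which agrees there with \<open>D1\<close>. From \<open>m\<close> on, its prefix
  counts are those of \<open>E1\<close>, since both sets have equally many elements up to
  \<open>m\<close>.\<close>

lemma below_splice:
  assumes 1: "E1 \<in> below D1" and 2: "E2 \<in> below D2"
    and D: "D1 \<inter> {..m} = D2 \<inter> {..m}" and c: "card (E1 \<inter> {..m}) = card (E2 \<inter> {..m})"
  shows "(E2 \<inter> {..m}) \<union> (E1 - {..m}) \<in> below D1"
proof -
  let ?E = "(E2 \<inter> {..m}) \<union> (E1 - {..m})"
  have fin: "finite E1" "finite E2" using 1 2 by (simp_all add: below_def)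
  have card: "card (?E \<inter> X) = card (E1 \<inter> X)" if "{..m} \<subseteq> X" for X
  proof -
    have "card (?E \<inter> X) = card ((E2 \<inter> {..m}) \<union> ((E1 - {..m}) \<inter> X))"
      using that by (intro arg_cong[where f = card]) auto
    also have "\<dots> = card (E2 \<inter> {..m}) + card ((E1 - {..m}) \<inter> X)"
      using fin by (intro card_Un_disjoint) auto
    also have "\<dots> = card (E1 \<inter> {..m}) + card ((E1 - {..m}) \<inter> X)" by (simp add: c)
    also have "\<dots> = card ((E1 \<inter> {..m}) \<union> ((E1 - {..m}) \<inter> X))"
      using fin by (intro card_Un_disjoint[symmetric]) auto
    also have "\<dots> = card (E1 \<inter> X)"
      using that by (intro arg_cong[where f = card]) auto
    finally show ?thesis .
  qed
  have "card (D1 \<inter> {..k}) \<le> card (?E \<inter> {..k})" for k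
  proof (cases "k \<le> m")
    case True
    then have "{..k} = {..m} \<inter> {..k}" by auto
    then have "D1 \<inter> {..k} = D2 \<inter> {..k}" using D by (metis inf_assoc)
    moreover have "?E \<inter> {..k} = E2 \<inter> {..k}" using True by auto
    ultimately show ?thesis using 2 by (simp add: below_def)
  next
    case False
    then have "card (?E \<inter> {..k}) = card (E1 \<inter> {..k})" by (intro card) auto
    then show ?thesis using 1 by (simp add: below_def)
  qed
  moreover have "card ?E = card E1" using card[of UNIV] by simp
  ultimately show ?thesis using 1 2 by (simp add: below_def)
qed

text \<open>A discrete intermediate value argument: the surplus of \<open>A\<close> over
  \<open>B\<close> falls by at most one per step, so it cannot jump over zero. The least
  \<open>m\<close> without a surplus has equality.\<close>

lemma card_prefix_crossing:
  fixes A B :: "nat set"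
  assumes "card (B \<inter> {..r}) < card (A \<inter> {..r})" "r \<le> k" "card (A \<inter> {..k}) \<le> card (B \<inter> {..k})"
  shows "\<exists>m. r < m \<and> m \<le> k \<and> card (A \<inter> {..m}) = card (B \<inter> {..m})"
proof -
  define m where "m = (LEAST m. r \<le> m \<and> card (A \<inter> {..m}) \<le> card (B \<inter> {..m}))"
  have m: "r \<le> m" "card (A \<inter> {..m}) \<le> card (B \<inter> {..m})" "m \<le> k"
    using LeastI[of "\<lambda>m. r \<le> m \<and> card (A \<inter> {..m}) \<le> card (B \<inter> {..m})" k]
      Least_le[of "\<lambda>m. r \<le> m \<and> card (A \<inter> {..m}) \<le> card (B \<inter> {..m})" k] assms(2,3)
    by (auto simp: m_def)
  have "r \<noteq> m" using m(2) assms(1) by auto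
  then obtain l where l: "m = Suc l" "r \<le> l" using m(1) by (cases m) auto
  have "\<not> (r \<le> l \<and> card (A \<inter> {..l}) \<le> card (B \<inter> {..l}))"
    using l(1) unfolding m_def by (intro not_less_Least) simp
  then have "card (B \<inter> {..l}) < card (A \<inter> {..l})" using l(2) by simp
  moreover have "card (A \<inter> {..l}) \<le> card (A \<inter> {..m})" using l(1) by (intro card_mono) auto
  moreover have "card (B \<inter> {..m}) \<le> Suc (card (B \<inter> {..l}))"
    by (simp add: l(1) atMost_Suc Int_insert_right card_insert_if)
  ultimately show ?thesis using m \<open>r \<noteq> m\<close> by (intro exI[of _ m]) simp
qed

text \<open>Match the elements in increasing order. If the element of index \<open>t\<close> of
  \<open>E\<close> (counting from 0) exceeded that of \<open>D\<close>, then up to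
  \<open>d t\<close> the set \<open>E\<close> would have at most \<open>t\<close> elements and
  \<open>D\<close> at least \<open>t + 1\<close>. This is the source of the strictly increasing
  columns.\<close>

lemma below_matching:
  assumes "E \<in> below D" "finite D"
  shows "\<exists>g. g ` D = E \<and> (\<forall>i \<in> D. \<forall>j \<in> D. i < j \<longrightarrow> g i < g j) \<and> (\<forall>i \<in> D. g i \<le> i)"
proof -
  have E: "finite E" "card E = card D" using assms(1) by (simp_all add: below_def)
  obtain d where d: "bij_betw d {..<card D} D" "strict_mono_on {..<card D} d"
    using ex_bij_betw_strict_mono_card[OF assms(2)] .
  obtain e where e: "bij_betw e {..<card D} E" "strict_mono_on {..<card D} e"
    using ex_bij_betw_strict_mono_card[OF E(1)] unfolding E(2) .
  define g where "g = e \<circ> inv_into {..<card D} d"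
  have g: "g (d t) = e t" if "t < card D" for t
    using d(1) that by (simp add: g_def bij_betw_def)
  have D: "D = d ` {..<card D}" and Ee: "E = e ` {..<card D}" using d(1) e(1) by (simp_all add: bij_betw_def)
  have dmono: "d s < d t \<longleftrightarrow> s < t" and emono: "e s < e t \<longleftrightarrow> s < t" if "s < card D" "t < card D" for s t
    using d(2) e(2) that by (auto simp: strict_mono_on_less)
  have idx: "\<exists>t<card D. d t = i" if "i \<in> D" for i
    using d(1) that unfolding bij_betw_def by (metis imageE lessThan_iff)
  have le: "e t \<le> d t" if t: "t < card D" for t
  proof (rule ccontr)
    assume a: "\<not> e t \<le> d t"
    have "d ` {..t} \<subseteq> D \<inter> {..d t}"
    proof
      fix x assume "x \<in> d ` {..t}"
      then obtain u where u: "u \<le> t" "x = d u" by blast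
      then have "d u \<in> D" using t d(1) by (auto simp: bij_betw_def)
      moreover have "\<not> d t < d u" using u t dmono by simp
      ultimately show "x \<in> D \<inter> {..d t}" using u by simp
    qed
    then have "card (d ` {..t}) \<le> card (D \<inter> {..d t})" by (intro card_mono) auto
    moreover have "inj_on d {..t}" using d(1) t by (auto simp: bij_betw_def intro: inj_on_subset)
    ultimately have "Suc t \<le> card (D \<inter> {..d t})" by (simp add: card_image)
    also have "\<dots> \<le> card (E \<inter> {..d t})" using assms(1) by (simp add: below_def)
    also have "E \<inter> {..d t} \<subseteq> e ` {..<t}"
    proof
      fix x assume x: "x \<in> E \<inter> {..d t}"
      then obtain s where s: "s < card D" "x = e s" using e(1) by (auto simp: bij_betw_def)
      then have "e s < e t" using x a by simp
      then show "x \<in> e ` {..<t}" using s t emono by auto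
    qed
    then have "card (E \<inter> {..d t}) \<le> card (e ` {..<t})" by (intro card_mono) auto
    also have "\<dots> \<le> t" using card_image_le[of "{..<t}" e] by simp
    finally show False by simp
  qed
  have "g i \<le> i" if "i \<in> D" for i
    using idx[OF that] g le by auto
  moreover have "g i < g j" if ij: "i \<in> D" "j \<in> D" "i < j" for i j
    using idx[OF ij(1)] idx[OF ij(2)] ij(3) g dmono emono by auto
  moreover have "g ` (d ` {..<card D}) = e ` {..<card D}"
    unfolding image_image using g by (intro image_cong) auto
  then have "g ` D = E" by (simp only: D[symmetric] Ee[symmetric])
  ultimately show ?thesis by blast
qed

section \<open>Fillings of Rothe diagrams and covers\<close>

definition rothe_col :: "nat \<Rightarrow> (nat \<Rightarrow> nat) \<Rightarrow> nat \<Rightarrow> nat set" where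
  "rothe_col n w j = {i \<in> {1..n}. j < w i \<and> i < inv w j}"

text \<open>Fillings up to reordering within columns. As the entries of a column are distinct, the
  multiplicity of \<open>k\<close> is the number of columns whose set contains
  \<open>k\<close>.\<close>

definition col_fillings :: "nat \<Rightarrow> (nat \<Rightarrow> nat) \<Rightarrow> (nat \<Rightarrow> nat) \<Rightarrow> (nat \<Rightarrow> nat set) set" where
  "col_fillings n w f = {E. (\<forall>j \<in> {1..n}. E j \<in> below (rothe_col n w j)) \<and>
     (\<forall>k. card {j \<in> {1..n}. k \<in> E j} = f k)}"

lemma finite_rothe_col [simp]: "finite (rothe_col n w j)"
  and zero_notin_rothe_col [simp]: "0 \<notin> rothe_col n w j"
  and rothe_col_subset: "rothe_col n w j \<subseteq> {1..n}"
  by (auto simp: rothe_col_def)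

lemma rothe_col_iff:
  assumes "w permutes {1..n}" "w p \<in> {1..n}"
  shows "i \<in> rothe_col n w (w p) \<longleftrightarrow> 1 \<le> i \<and> i < p \<and> w p < w i"
proof -
  have "p \<in> {1..n}" using assms permutes_in_image by metis
  then show ?thesis by (auto simp: rothe_col_def permutes_inverses(2)[OF assms(1)])
qed

lemma card_transpose_columns:
  assumes "a \<in> {1..n}" "c \<in> {1..n}" and "\<And>j. j \<in> {1..n} \<Longrightarrow> k \<in> E' j \<longleftrightarrow> k \<in> E (transpose a c j)"
  shows "card {j \<in> {1..n}. k \<in> E' j} = card {j \<in> {1..n}. k \<in> E j}"
proof (rule bij_betw_same_card[of "transpose a c"])
  have "transpose a c j \<in> {1..n}" if "j \<in> {1..n}" for j
    using assms that by (auto simp: transpose_def)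
  then show "bij_betw (transpose a c) {j \<in> {1..n}. k \<in> E' j} {j \<in> {1..n}. k \<in> E j}"
    using assms(3) by (intro bij_betw_byWitness[where f' = "transpose a c"]) auto
qed

text \<open>Columns \<open>j\<close> and \<open>c\<close> trade their entries up to a level
  \<open>m > r\<close> at which they have equally many. Contents are unchanged, and \<open>j\<close>
  receives the initial segment of \<open>c\<close>, which lacks \<open>r\<close>.\<close>

lemma col_fillings_exchange:
  assumes E: "E \<in> col_fillings n w f" and j: "j \<in> {1..n}" and c: "c \<in> {1..n}"
    and pre: "{1..<r} \<subseteq> rothe_col n w j" "{1..<r} \<subseteq> rothe_col n w c"
    and r: "1 \<le> r" "r \<le> k" "r \<in> E j" "r \<notin> E c"
    and D: "rothe_col n w j \<inter> {..k} = rothe_col n w c \<inter> {..k}"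
    and le: "card (E j \<inter> {..k}) \<le> card (E c \<inter> {..k})"
  shows "\<exists>E' \<in> col_fillings n w f. r \<notin> E' j"
proof -
  have jc: "j \<noteq> c" using r by auto
  have bj: "E j \<in> below (rothe_col n w j)" and bc: "E c \<in> below (rothe_col n w c)"
    using E j c by (simp_all add: col_fillings_def)
  \<comment> \<open>Below \<open>r\<close> both columns are full, so up to \<open>r\<close> they
    differ only in \<open>r\<close> itself. This surplus of column \<open>j\<close> starts the
    search for the crossing level.\<close>
  have "E c \<inter> {..r} \<subset> E j \<inter> {..r}"
  proof -
    have "{1..<r} \<subseteq> E j" using below_prefix[OF bj pre(1)] .
    moreover have "0 \<notin> E c" using bc by (simp add: below_def)
    ultimately have "x \<in> E j" if "x \<in> E c" "x \<le> r" for x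
      using that r by (cases "x = 0 \<or> x = r") auto
    then show ?thesis using r by blast
  qed
  then have "card (E c \<inter> {..r}) < card (E j \<inter> {..r})" by (intro psubset_card_mono) auto
  then obtain m where m: "r < m" "m \<le> k" "card (E j \<inter> {..m}) = card (E c \<inter> {..m})"
    using card_prefix_crossing[OF _ r(2) le] by blast
  have Dm: "rothe_col n w j \<inter> {..m} = rothe_col n w c \<inter> {..m}"
  proof -
    have "{..m} = {..k} \<inter> {..m}" using m(2) by auto
    then show ?thesis using D by (metis inf_assoc)
  qed
  define E' where "E' = E(j := (E c \<inter> {..m}) \<union> (E j - {..m}), c := (E j \<inter> {..m}) \<union> (E c - {..m}))"
  have "E' j \<in> below (rothe_col n w j)"
    using below_splice[OF bj bc Dm m(3)] jc by (simp add: E'_def)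
  moreover have "E' c \<in> below (rothe_col n w c)"
    using below_splice[OF bc bj Dm[symmetric] m(3)[symmetric]] jc by (simp add: E'_def)
  ultimately have "\<forall>i \<in> {1..n}. E' i \<in> below (rothe_col n w i)"
    using E jc by (auto simp: E'_def col_fillings_def)
  moreover have "card {i \<in> {1..n}. x \<in> E' i} = card {i \<in> {1..n}. x \<in> E i}" for x
  proof (cases "x \<le> m")
    case True
    then show ?thesis using jc by (intro card_transpose_columns[OF j c]) (auto simp: E'_def transpose_def)
  next
    case False
    then have "x \<in> E' i \<longleftrightarrow> x \<in> E i" for i using jc by (auto simp: E'_def)
    then show ?thesis by simp
  qed
  ultimately have "E' \<in> col_fillings n w f" using E by (simp add: col_fillings_def)
  moreover have "r \<notin> E' j" using r m jc by (auto simp: E'_def)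
  ultimately show ?thesis by blast
qed

section \<open>Columns of the Rothe diagram along a cover\<close>

context
  fixes n r s :: nat and w :: "nat \<Rightarrow> nat"
  assumes w: "w permutes {1..n}" and r: "1 \<le> r" and pre: "\<forall>q \<in> {1..<r}. w q = n + 1 - q"
    and s: "s \<in> covers n w r"
begin

private abbreviation "v \<equiv> w \<circ> transpose r s"

lemma cover_facts:
  shows "r < s" "s \<in> {1..n}" "r \<in> {1..n}" "w r < w s" "w r \<in> {1..n}" "w s \<in> {1..n}" "v permutes {1..n}"
    and "w s \<le> n + 1 - r"
proof -
  show rs: "r < s" "s \<in> {1..n}" "r \<in> {1..n}" "w r < w s" using s r by (auto simp: covers_def)
  then show "w r \<in> {1..n}" "w s \<in> {1..n}"
    by (simp_all only: permutes_in_image[OF w])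
  show "v permutes {1..n}" using rs by (intro permutes_swap_compose[OF w])
  show "w s \<le> n + 1 - r" using rs by (intro perm_le_of_prefix[OF w pre]) auto
qed

lemma prefix_gt: "w s < w q" "w r < w q" if "1 \<le> q" "q < r"
proof -
  have "w q = n + 1 - q" using pre that by simp
  then show "w s < w q" "w r < w q" using cover_facts(3,4,8) that by auto
qed

lemma cover_between: "r < q \<Longrightarrow> q < s \<Longrightarrow> w r < w q \<longleftrightarrow> w s < w q"
  using s permutes_apply_eq_iff[OF w, of q s] cover_facts(4) by (fastforce simp: covers_def)

text \<open>Rows before \<open>r\<close> have values above \<open>w s\<close>, and the cover
  condition excludes the rows between \<open>r\<close> and \<open>s\<close>.\<close>

lemma between_after_cover:
  assumes "w r < w p" "w p < w s"
  shows "s < p"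
proof (rule ccontr)
  assume "\<not> s < p"
  then consider "p = 0" | "1 \<le> p" "p < r" | "p = r" | "r < p" "p < s" | "p = s" by linarith
  then show False
  proof cases
    case 1
    then have "w p = 0" using permutes_not_in[OF w, of 0] by simp
    then show ?thesis using assms(1) by simp
  qed (use assms prefix_gt cover_between in auto, fastforce+)
qed

lemma rothe_col_cover_other:
  assumes "j \<in> {1..n}" "j < w r \<or> w s < j"
  shows "rothe_col n v j = rothe_col n w j"
proof -
  obtain p where p: "j = w p" using permutes_inverses(1)[OF w] by metis
  have "p \<noteq> r" "p \<noteq> s" using assms(2) p cover_facts(4) by auto
  then have vp: "v p = w p" by simp
  have "w p < v i \<longleftrightarrow> w p < w i" for i
    using assms(2) p cover_facts(4) by (auto simp: transpose_def)
  then show ?thesis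
    using rothe_col_iff[OF w, of p] rothe_col_iff[OF cover_facts(7), of p] assms(1) unfolding vp p by blast
qed

text \<open>The row in which the value \<open>j\<close> sits lies below both swapped rows. The
  larger value \<open>w s\<close> moves from row \<open>s\<close> to row \<open>r\<close>, and the
  box of column \<open>j\<close> moves with it.\<close>

lemma rothe_col_cover_between:
  assumes "w r < j" "j < w s"
  shows "rothe_col n v j = insert r (rothe_col n w j - {s})" "s \<in> rothe_col n w j" "r \<notin> rothe_col n w j"
proof -
  obtain p where p: "j = w p" using permutes_inverses(1)[OF w] by metis
  have sp: "s < p" using between_after_cover assms p by simp
  then have vp: "v p = w p" using cover_facts(1) by simp
  have jn: "w p \<in> {1..n}" using assms cover_facts(5,6) p by auto
  have "w p < v i \<longleftrightarrow> i = r \<or> (i \<noteq> s \<and> w p < w i)" for i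
    using assms p by (auto simp: transpose_def)
  then have "i \<in> rothe_col n v (v p) \<longleftrightarrow> i \<in> insert r (rothe_col n w (w p) - {s})" for i
    using rothe_col_iff[OF cover_facts(7), of p i] rothe_col_iff[OF w, of p i] vp jn sp r cover_facts(1) by auto
  then show "rothe_col n v j = insert r (rothe_col n w j - {s})" unfolding vp p by blast
  show "s \<in> rothe_col n w j" "r \<notin> rothe_col n w j"
    using assms jn p sp cover_facts(2) by (auto simp: rothe_col_iff[OF w])
qed

text \<open>Rows strictly between \<open>r\<close> and \<open>s\<close> have values above both
  \<open>w r\<close> and \<open>w s\<close> or below both, so there the two columns have the same
  boxes. The only new box is the one in row \<open>r\<close>.\<close>

lemma rothe_col_cover_ends:
  shows "rothe_col n w (w r) = {1..<r}" "rothe_col n v (w s) = {1..<r}"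
    and "rothe_col n v (w r) = insert r (rothe_col n w (w s))" "r \<notin> rothe_col n w (w s)"
    and "{1..<r} \<subseteq> rothe_col n w (w s)"
proof -
  have vr: "v r = w s" and vs: "v s = w r" by simp_all
  have vo: "v i = w i" if "i \<noteq> r" "i \<noteq> s" for i using that by simp
  note iff = rothe_col_iff[OF w cover_facts(5)] rothe_col_iff[OF w cover_facts(6)]
  have iff': "i \<in> rothe_col n v (w s) \<longleftrightarrow> 1 \<le> i \<and> i < r \<and> w s < v i"
    "i \<in> rothe_col n v (w r) \<longleftrightarrow> 1 \<le> i \<and> i < s \<and> w r < v i" for i
    using rothe_col_iff[OF cover_facts(7), of r i] rothe_col_iff[OF cover_facts(7), of s i]
      cover_facts(5,6) unfolding vr vs by simp_all
  show "rothe_col n w (w r) = {1..<r}" using prefix_gt by (auto simp: iff)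
  show "rothe_col n v (w s) = {1..<r}" using prefix_gt cover_facts(1) vo by (auto simp: iff')
  show "r \<notin> rothe_col n w (w s)" using cover_facts(4) by (auto simp: iff)
  show "{1..<r} \<subseteq> rothe_col n w (w s)" using prefix_gt cover_facts(1) by (auto simp: iff)
  have "i \<in> rothe_col n v (w r) \<longleftrightarrow> i \<in> insert r (rothe_col n w (w s))" for i
  proof -
    consider "i = 0" | "1 \<le> i" "i < r" | "i = r" | "r < i" "i < s" | "s \<le> i" by linarith
    then show ?thesis
      by cases (use iff iff' vo vr r cover_facts(1,4) prefix_gt cover_between in auto)
  qed
  then show "rothe_col n v (w r) = insert r (rothe_col n w (w s))" by blast
qed

lemma col_fillings_from_cover:
  assumes E': "E' \<in> col_fillings n v (f(r := f r + 1))"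
  shows "\<exists>E. E \<in> col_fillings n w f"
proof -
  let ?a = "w r" and ?b = "w s"
  note [simp del] = One_nat_def
  have ab: "?a \<in> {1..n}" "?b \<in> {1..n}" "?a \<noteq> ?b" using cover_facts by auto
  have below: "E' j \<in> below (rothe_col n v j)" if "j \<in> {1..n}" for j
    using E' that by (simp add: col_fillings_def)
  have Ea: "E' ?a \<in> below (insert r (rothe_col n w ?b))"
    using below[OF ab(1)] rothe_col_cover_ends(3) by simp
  have Eb: "E' ?b = {1..<r}"
    using below[OF ab(2)] rothe_col_cover_ends(2) below_initial by simp
  \<comment> \<open>All rows up to \<open>r\<close> belong to this column of the cover, which forces
    the entry \<open>r\<close> into it; this is the \<open>r\<close> to be removed.\<close>
  have "{1..<r + 1} \<subseteq> insert r (rothe_col n w ?b)"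
    using rothe_col_cover_ends(5) by (auto simp: less_Suc_eq subset_iff)
  from below_prefix[OF Ea this] have ra: "r \<in> E' ?a" using r by (auto simp: subset_iff)
  define E where "E = (\<lambda>j. E' (transpose ?a ?b j))(?b := E' ?a - {r})"
  have "E j \<in> below (rothe_col n w j)" if j: "j \<in> {1..n}" for j
  proof -
    consider "j = ?a" | "j = ?b" | "?a < j" "j < ?b" | "j < ?a \<or> ?b < j" by linarith
    then show ?thesis
    proof cases
      case 1
      then show ?thesis using ab Eb rothe_col_cover_ends(1) by (simp add: E_def below_initial)
    next
      case 2
      then show ?thesis
        using below_remove[OF Ea rothe_col_cover_ends(4) ra] by (simp add: E_def)
    next
      case 3
      have "E' j \<in> below (insert r (rothe_col n w j - {s}))"
        using below[OF j] rothe_col_cover_between(1)[OF 3] by simp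
      moreover have "insert r (rothe_col n w j - {s}) \<in> below (rothe_col n w j)"
        using rothe_col_cover_between[OF 3] cover_facts(1) r by (intro below_insert_remove) auto
      ultimately have "E' j \<in> below (rothe_col n w j)" by (rule below_trans)
      then show ?thesis using 3 by (simp add: E_def)
    next
      case 4
      then have "j \<noteq> ?a" "j \<noteq> ?b" using cover_facts(4) by auto
      then show ?thesis using below[OF j] rothe_col_cover_other[OF j 4] by (simp add: E_def)
    qed
  qed
  moreover have "card {j \<in> {1..n}. k \<in> E j} = f k" for k
  proof (cases "k = r")
    case True
    have "{j \<in> {1..n}. r \<in> E j} = {j \<in> {1..n}. r \<in> E' j} - {?a}"
      using ab Eb by (auto simp: E_def transpose_def)
    moreover have "card {j \<in> {1..n}. r \<in> E' j} = f r + 1" using E' by (simp add: col_fillings_def)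
    ultimately show ?thesis using True ra ab(1) by (simp add: card_Diff_singleton)
  next
    case False
    have "card {j \<in> {1..n}. k \<in> E j} = card {j \<in> {1..n}. k \<in> E' j}"
      using False by (intro card_transpose_columns[OF ab(1,2)]) (auto simp: E_def)
    then show ?thesis using E' False by (simp add: col_fillings_def)
  qed
  ultimately show ?thesis by (intro exI[of _ E]) (simp add: col_fillings_def)
qed

text \<open>Reverses the previous construction. The hypothesis \<open>rs\<close> leaves room for the
  new entry \<open>r\<close> in the column that moves from \<open>w s\<close> to \<open>w r\<close>,
  and \<open>slack\<close> pays for lifting a box from row \<open>s\<close> to row \<open>r\<close>
  in each column between.\<close>

lemma col_fillings_to_cover:
  assumes E: "E \<in> col_fillings n w f" and rs: "r \<notin> E (w s)"
    and slack: "\<And>j k. w r < j \<Longrightarrow> j < w s \<Longrightarrow> r \<le> k \<Longrightarrow> k < s \<Longrightarrow>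
      card (rothe_col n w j \<inter> {..k}) < card (E j \<inter> {..k})"
  shows "\<exists>E'. E' \<in> col_fillings n v (f(r := f r + 1))"
proof -
  let ?a = "w r" and ?b = "w s"
  note [simp del] = One_nat_def
  have ab: "?a \<in> {1..n}" "?b \<in> {1..n}" "?a \<noteq> ?b" using cover_facts by auto
  have below: "E j \<in> below (rothe_col n w j)" if "j \<in> {1..n}" for j
    using E that by (simp add: col_fillings_def)
  have Ea: "E ?a = {1..<r}"
    using below[OF ab(1)] rothe_col_cover_ends(1) below_initial by simp
  define E' where "E' = (\<lambda>j. E (transpose ?a ?b j))(?a := insert r (E ?b))"
  have "E' j \<in> below (rothe_col n v j)" if j: "j \<in> {1..n}" for j
  proof -
    consider "j = ?a" | "j = ?b" | "?a < j" "j < ?b" | "j < ?a \<or> ?b < j" by linarith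
    then show ?thesis
    proof cases
      case 1
      then show ?thesis
        using below_insert[OF below[OF ab(2)] rothe_col_cover_ends(4) rs] r rothe_col_cover_ends(3)
        by (simp add: E'_def)
    next
      case 2
      then show ?thesis using ab Ea rothe_col_cover_ends(2) by (simp add: E'_def below_initial)
    next
      case 3
      have "E j \<in> below (insert r (rothe_col n w j - {s}))"
        using rothe_col_cover_between[OF 3] cover_facts(1) slack[OF 3]
        by (intro below_replace[OF below[OF j]]) auto
      then show ?thesis using 3 rothe_col_cover_between(1)[OF 3] by (simp add: E'_def)
    next
      case 4
      then have "j \<noteq> ?a" "j \<noteq> ?b" using cover_facts(4) by auto
      then show ?thesis using below[OF j] rothe_col_cover_other[OF j 4] by (simp add: E'_def)
    qed
  qed
  moreover have "card {j \<in> {1..n}. k \<in> E' j} = (f(r := f r + 1)) k" for k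
  proof (cases "k = r")
    case True
    have "{j \<in> {1..n}. r \<in> E' j} = insert ?a {j \<in> {1..n}. r \<in> E j}"
      using ab Ea rs by (auto simp: E'_def transpose_def)
    moreover have "card {j \<in> {1..n}. r \<in> E j} = f r" using E by (simp add: col_fillings_def)
    ultimately show ?thesis using True Ea by simp
  next
    case False
    have "card {j \<in> {1..n}. k \<in> E' j} = card {j \<in> {1..n}. k \<in> E j}"
      using False by (intro card_transpose_columns[OF ab(1,2)]) (auto simp: E'_def)
    then show ?thesis using E False by (simp add: col_fillings_def)
  qed
  ultimately show ?thesis by (intro exI[of _ E']) (simp add: col_fillings_def)
qed

end

lemma perm_less_of_prefix:
  fixes n :: nat
  assumes w: "w permutes {1..n}" and r: "r \<in> {1..n}" and min: "\<forall>q \<in> {1..<r}. w q = n + 1 - q"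
    and "w r \<noteq> n + 1 - r"
  shows "w r < n + 1 - r"
  using perm_le_of_prefix[OF w min, of r] r assms(4) by simp

text \<open>Among all fillings, choose one in which the leftmost column \<open>c > w r\<close> without the entry
  \<open>r\<close> is as far to the left as possible. Exchanging initial segments of columns then shows that
  \<open>c\<close> is the value of a cover and that the columns in between have room for an extra \<open>r\<close>.\<close>

lemma col_fillings_ex_cover:
  assumes w: "w permutes {1..n}" and r: "1 \<le> r" and pre: "\<forall>q \<in> {1..<r}. w q = n + 1 - q"
    and lt: "w r < n + 1 - r" and E0: "E0 \<in> col_fillings n w f"
  shows "\<exists>s \<in> covers n w r. \<exists>E'. E' \<in> col_fillings n (w \<circ> transpose r s) (f(r := f r + 1))"
proof -
  note [simp del] = One_nat_def
  have wp: "w q \<in> {1..n} \<longleftrightarrow> q \<in> {1..n}" for q by (rule permutes_in_image[OF w])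
  have inj: "w i = w j \<longleftrightarrow> i = j" for i j by (rule permutes_apply_eq_iff[OF w])
  have rn: "r \<in> {1..n}" using r lt by simp
  then have wr: "1 \<le> w r" using wp[of r] by simp
  then have r_lt: "r < n" using lt by linarith
  define Q where "Q c \<longleftrightarrow> w r < c \<and> c \<le> n + 1 - r \<and> (\<exists>E \<in> col_fillings n w f. r \<notin> E c)" for c
  have pre_gt: "n + 1 - r < w q" if "1 \<le> q" "q < r" for q
    using pre that r_lt by auto
  have pos: "r < p" if "w r < w p" "w p \<le> n + 1 - r" for p
  proof (rule ccontr)
    assume "\<not> r < p"
    then consider "p = 0" | "1 \<le> p" "p < r" | "p = r" by linarith
    then show False
      by cases (use that pre_gt permutes_not_in[OF w, of 0] in force)+
  qed
  have sub: "{1..<r} \<subseteq> rothe_col n w (w p)" if "w r < w p" "w p \<le> n + 1 - r" for p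
  proof
    fix i assume i: "i \<in> {1..<r}"
    have "w p \<in> {1..n}" using that r by auto
    moreover have "w p < w i" using i pre_gt[of i] that by auto
    ultimately show "i \<in> rothe_col n w (w p)" using i pos[OF that] by (simp add: rothe_col_iff[OF w])
  qed
  \<comment> \<open>The minimum exists: rows from \<open>r\<close> on have values at most
    \<open>n + 1 - r\<close>, so this column has boxes only in rows before \<open>r\<close> and
    cannot contain the entry \<open>r\<close>.\<close>
  have "Q (n + 1 - r)"
  proof -
    define p where "p = inv w (n + 1 - r)"
    have p: "w p = n + 1 - r" by (simp add: p_def permutes_inverses[OF w])
    have "w p \<in> {1..n}" using p r rn by auto
    then have "p \<in> {1..n}" using wp by simp
    have "rothe_col n w (w p) = {1..<r}"
    proof
      show "rothe_col n w (w p) \<subseteq> {1..<r}"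
      proof
        fix i assume "i \<in> rothe_col n w (w p)"
        then have i: "1 \<le> i" "i < p" "w p < w i" using \<open>w p \<in> {1..n}\<close> by (simp_all add: rothe_col_iff[OF w])
        then have "\<not> r \<le> i" using perm_le_of_prefix[OF w pre, of i] \<open>p \<in> {1..n}\<close> p by auto
        then show "i \<in> {1..<r}" using i by simp
      qed
    qed (use sub[of p] p lt in simp)
    moreover have "E0 (w p) \<in> below (rothe_col n w (w p))"
      using E0 \<open>w p \<in> {1..n}\<close> by (simp add: col_fillings_def)
    ultimately have "E0 (w p) = {1..<r}" using below_initial by simp
    then show ?thesis using E0 lt unfolding Q_def p by auto
  qed
  define c where "c = (LEAST c. Q c)"
  have Qc: "Q c" unfolding c_def using \<open>Q (n + 1 - r)\<close> by (rule LeastI)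
  have notQ: "\<not> Q j" if "j < c" for j using that not_less_Least unfolding c_def by blast
  define s where "s = inv w c"
  have ws: "w s = c" by (simp add: s_def permutes_inverses[OF w])
  obtain E where E: "E \<in> col_fillings n w f" "r \<notin> E c" and c: "w r < c" "c \<le> n + 1 - r"
    using Qc by (auto simp: Q_def)
  have cn: "c \<in> {1..n}" using c r by auto
  have rs: "r < s" using pos[of s] ws c by simp
  have sn: "s \<in> {1..n}" using wp[of s] ws cn by simp
  have colc: "i \<in> rothe_col n w c \<longleftrightarrow> 1 \<le> i \<and> i < s \<and> c < w i" for i
    using rothe_col_iff[OF w, of s i] ws cn by simp
  \<comment> \<open>By minimality of \<open>c\<close> the column \<open>w q\<close> contains
    \<open>r\<close>. If it could exchange an initial segment with column \<open>c\<close>, a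
    filling without \<open>r\<close> in column \<open>w q\<close> would arise, against
    minimality.\<close>
  have exch: False if q: "w r < w q" "w q < c" "r \<le> k"
    and D: "rothe_col n w (w q) \<inter> {..k} = rothe_col n w c \<inter> {..k}"
    and le: "card (E (w q) \<inter> {..k}) \<le> card (E c \<inter> {..k})" for q k
  proof -
    have q': "w q \<le> n + 1 - r" "w q \<in> {1..n}" using q c r by auto
    have "r \<in> E (w q)" using notQ[OF q(2)] q(1) q'(1) E(1) by (auto simp: Q_def)
    moreover have "{1..<r} \<subseteq> rothe_col n w c" using sub[of s] ws c by simp
    ultimately obtain E' where "E' \<in> col_fillings n w f" "r \<notin> E' (w q)"
      using col_fillings_exchange[OF E(1) q'(2) cn sub[OF q(1) q'(1)] _ r q(3) _ E(2) D le] by blast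
    then show False using notQ[OF q(2)] q(1) q'(1) by (auto simp: Q_def)
  qed
  have cover: "s \<in> covers n w r"
  proof (rule ccontr)
    assume "s \<notin> covers n w r"
    then have ex: "\<exists>q. r < q \<and> q < s \<and> w r < w q \<and> w q < c"
      using rs sn c ws by (auto simp: covers_def)
    \<comment> \<open>Up to the first blocking row \<open>q\<close>, the columns \<open>w q\<close>
      and \<open>c\<close> have the same boxes, and column \<open>w q\<close> has no others. So
      column \<open>c\<close> has at least as many entries up to \<open>q\<close> as column
      \<open>w q\<close> has altogether, and \<open>exch\<close> applies.\<close>
    define q where "q = (LEAST q. r < q \<and> q < s \<and> w r < w q \<and> w q < c)"
    have q: "r < q" "q < s" "w r < w q" "w q < c"
      using LeastI_ex[OF ex] by (simp_all add: q_def)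
    have first: "\<not> (w r < w i \<and> w i < c)" if "r < i" "i < q" for i
      using not_less_Least[of i "\<lambda>q. r < q \<and> q < s \<and> w r < w q \<and> w q < c"] that q(2)
      unfolding q_def[symmetric] by auto
    have wq: "w q \<in> {1..n}" using q c r by auto
    have col: "i \<in> rothe_col n w (w q) \<longleftrightarrow> i \<in> rothe_col n w c" if iq: "i \<le> q" for i
    proof -
      consider "i = 0" | "1 \<le> i" "i < r" | "i = r" | "r < i" "i < q" | "i = q" using iq by linarith
      then show ?thesis
      proof cases
        case 2
        then show ?thesis using pre_gt[of i] q c rothe_col_iff[OF w wq, of i] colc[of i] by simp
      next
        case 4
        then have "w i \<noteq> c" using inj[of i s] ws q by auto
        then show ?thesis using first[OF 4] 4 q rothe_col_iff[OF w wq, of i] colc[of i] by auto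
      qed (use q c rothe_col_iff[OF w wq, of i] colc[of i] in auto)
    qed
    have D: "rothe_col n w (w q) \<inter> {..q} = rothe_col n w c \<inter> {..q}" using col by auto
    have "rothe_col n w (w q) \<inter> {..q} = rothe_col n w (w q)" by (auto simp: rothe_col_iff[OF w wq])
    then have "card (rothe_col n w (w q)) = card (rothe_col n w c \<inter> {..q})" using D by simp
    also have "\<dots> \<le> card (E c \<inter> {..q})" using E(1) cn by (simp add: col_fillings_def below_def)
    finally have "card (E (w q)) \<le> card (E c \<inter> {..q})" "finite (E (w q))"
      using E(1) wq by (auto simp: col_fillings_def below_def)
    then have "card (E (w q) \<inter> {..q}) \<le> card (E c \<inter> {..q})"
      by (meson card_mono inf_le1 order_trans)
    then show False using exch[OF q(3,4) _ D] q(1) by simp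
  qed
  \<comment> \<open>Above row \<open>s\<close>, an intermediate column has the same boxes as column
    \<open>c\<close>. Without slack at \<open>k\<close> it therefore has at most as many entries up
    to \<open>k\<close> as column \<open>c\<close>, which \<open>exch\<close> forbids.\<close>
  have "card (rothe_col n w j \<inter> {..k}) < card (E j \<inter> {..k})"
    if j: "w r < j" "j < w s" and k: "r \<le> k" "k < s" for j k
  proof (rule ccontr)
    assume a: "\<not> card (rothe_col n w j \<inter> {..k}) < card (E j \<inter> {..k})"
    obtain p where p: "j = w p" using permutes_inverses(1)[OF w] by metis
    have wpn: "w p \<in> {1..n}" using j p cn ws by auto
    have sp: "s < p" using between_after_cover[OF w r pre cover] j p by simp
    have "i \<in> rothe_col n w (w p) \<longleftrightarrow> i \<in> rothe_col n w c" if "i < s" for i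
    proof -
      consider "i = 0" | "1 \<le> i" "i < r" | "i = r" | "r < i" by linarith
      then show ?thesis
      proof cases
        case 2
        then show ?thesis using pre_gt[of i] that sp j p c ws rothe_col_iff[OF w wpn, of i] colc[of i] by simp
      next
        case 4
        then show ?thesis
          using cover_between[OF w r pre cover 4 that] that sp j p ws unfolding rothe_col_iff[OF w wpn] colc
          by linarith
      qed (use that j p c ws rothe_col_iff[OF w wpn, of i] colc[of i] in auto)
    qed
    then have D: "rothe_col n w (w p) \<inter> {..k} = rothe_col n w c \<inter> {..k}" using k by auto
    have "card (E (w p) \<inter> {..k}) \<le> card (rothe_col n w c \<inter> {..k})" using a p D by simp
    also have "\<dots> \<le> card (E c \<inter> {..k})" using E(1) cn by (simp add: col_fillings_def below_def)
    finally show False using exch[OF _ _ k(1) D] j p ws by simp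
  qed
  then show ?thesis
    using col_fillings_to_cover[OF w r pre cover E(1)] E(2) ws cover by blast
qed

section \<open>The support of a Schubert polynomial\<close>

lemma rothe_col_longest:
  assumes "j \<in> {1..n}"
  shows "rothe_col n (longest_perm n) j = {1..<n + 1 - j}"
proof -
  have eq: "longest_perm n (n + 1 - j) = j" using assms by (auto simp: longest_perm_def)
  have "i \<in> rothe_col n (longest_perm n) (longest_perm n (n + 1 - j)) \<longleftrightarrow> i \<in> {1..<n + 1 - j}" for i
    using assms by (subst rothe_col_iff[OF longest_perm_permutes]) (auto simp: longest_perm_def)
  then show ?thesis unfolding eq by (rule set_eqI)
qed

text \<open>Every column is an initial segment, so the family is forced, and its content is the
  exponent vector of the staircase monomial. The index 0 is singled out because \<open>n - 0\<close>
  is not 0 in general.\<close>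

lemma col_fillings_longest:
  "col_fillings n (longest_perm n) f \<noteq> {} \<longleftrightarrow> f = (\<lambda>k. if k = 0 then 0 else n - k)"
proof -
  have count: "card {j \<in> {1..n}. k \<in> {1..<n + 1 - j}} = (if k = 0 then 0 else n - k)" for k
  proof -
    have "{j \<in> {1..n}. k \<in> {1..<n + 1 - j}} = (if k = 0 then {} else {1..n - k})" by auto
    then show ?thesis by simp
  qed
  have "E \<in> col_fillings n (longest_perm n) f \<longleftrightarrow>
    (\<forall>j \<in> {1..n}. E j = {1..<n + 1 - j}) \<and> f = (\<lambda>k. if k = 0 then 0 else n - k)" for E
  proof -
    have "card {j \<in> {1..n}. k \<in> E j} = (if k = 0 then 0 else n - k)"
      if "\<forall>j \<in> {1..n}. E j = {1..<n + 1 - j}" for k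
      unfolding count[symmetric] using that by (intro arg_cong[where f = card]) auto
    then show ?thesis
      by (auto simp: col_fillings_def rothe_col_longest below_initial fun_eq_iff simp del: One_nat_def)
  qed
  then show ?thesis by auto
qed

lemma var_power: "var i ^ m = Poly_Mapping.single (Poly_Mapping.single i m) 1"
  by (induction m) (simp_all add: var_def mult_single flip: single_add)

lemma prod_single: "(\<Prod>i\<in>A. Poly_Mapping.single (g i) (1::int)) = Poly_Mapping.single (sum g A) 1"
  for g :: "'b \<Rightarrow> nat \<Rightarrow>\<^sub>0 nat"
  by (induction A rule: infinite_finite_induct) (simp_all add: mult_single)

lemma coeff_schubert_longest:
  "coeff (schubert n (longest_perm n)) \<alpha>
    = (if Poly_Mapping.lookup \<alpha> = (\<lambda>k. if k = 0 then 0 else n - k) then 1 else 0)"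
proof -
  define \<delta> where "\<delta> = (\<Sum>i = 1..n. Poly_Mapping.single i (n - i))"
  have "Poly_Mapping.lookup \<delta> k = (\<Sum>i = 1..n. if i = k then n - k else 0)" for k
    unfolding \<delta>_def lookup_sum by (intro sum.cong) (auto simp: lookup_single)
  then have "Poly_Mapping.lookup \<delta> = (\<lambda>k. if k = 0 then 0 else n - k)" by auto
  moreover have "schubert n (longest_perm n) = Poly_Mapping.single \<delta> 1"
    by (simp only: schubert_longest var_power prod_single \<delta>_def)
  ultimately show ?thesis
    by (auto simp: coeff_def lookup_single when_def poly_mapping_eq_iff)
qed

lemma coeff_var_mult: "coeff (var i * f) (Poly_Mapping.single i 1 + \<alpha>) = coeff f \<alpha>"
proof -
  have "Poly_Mapping.lookup (var i * f) (Poly_Mapping.single i 1 + \<alpha>) = Poly_Mapping.lookup f \<alpha>"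
    by (induction f rule: poly_mapping_sum_induct)
      (simp_all add: var_def mult_single lookup_single lookup_add distrib_left)
  then show ?thesis by (simp add: coeff_def)
qed

text \<open>Nonnegativity is part of the induction: only without negative summands is a sum over the
  covers positive exactly when some summand is.\<close>

theorem coeff_schubert_pos_iff:
  assumes "w permutes {1..n}"
  shows "coeff (schubert n w) \<alpha> \<ge> 0 \<and>
    (coeff (schubert n w) \<alpha> > 0 \<longleftrightarrow> col_fillings n w (Poly_Mapping.lookup \<alpha>) \<noteq> {})"
  using assms
proof (induction "perm_weight n w" arbitrary: w \<alpha> rule: less_induct)
  case less
  note w = less.prems
  show ?case
  proof (cases "w = longest_perm n")
    case True
    then show ?thesis by (simp add: coeff_schubert_longest col_fillings_longest)
  next
    case False
    then obtain i where "w i \<noteq> longest_perm n i" by blast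
    then have ex: "\<exists>r. 1 \<le> r \<and> r \<le> n \<and> w r \<noteq> n + 1 - r"
      using permutes_not_in[OF w, of i] by (auto simp: longest_perm_def split: if_splits)
    define r where "r = (LEAST r. 1 \<le> r \<and> r \<le> n \<and> w r \<noteq> n + 1 - r)"
    have r: "1 \<le> r" "r \<le> n" "w r \<noteq> n + 1 - r" using LeastI_ex[OF ex] by (simp_all add: r_def)
    have pre: "\<forall>q \<in> {1..<r}. w q = n + 1 - q"
    proof
      fix q assume q: "q \<in> {1..<r}"
      then have "\<not> (1 \<le> q \<and> q \<le> n \<and> w q \<noteq> n + 1 - q)"
        unfolding r_def by (intro not_less_Least) simp
      then show "w q = n + 1 - q" using q r by auto
    qed
    have lt: "w r < n + 1 - r" using r by (intro perm_less_of_prefix[OF w _ pre]) auto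
    let ?v = "\<lambda>s. w \<circ> transpose r s" and ?\<beta> = "Poly_Mapping.single r 1 + \<alpha>"
    have \<beta>: "Poly_Mapping.lookup ?\<beta> = (Poly_Mapping.lookup \<alpha>)(r := Poly_Mapping.lookup \<alpha> r + 1)"
      by (auto simp: lookup_add lookup_single)
    have "coeff (schubert n w) \<alpha> = coeff (var r * schubert n w) ?\<beta>" by (simp only: coeff_var_mult)
    also have "\<dots> = (\<Sum>s \<in> covers n w r. coeff (schubert n (?v s)) ?\<beta>)"
      by (simp add: cotransition[OF w r(1) pre lt] coeff_def lookup_sum)
    finally have sum: "coeff (schubert n w) \<alpha> = (\<Sum>s \<in> covers n w r. coeff (schubert n (?v s)) ?\<beta>)" .
    have IH: "coeff (schubert n (?v s)) ?\<beta> \<ge> 0"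
      "coeff (schubert n (?v s)) ?\<beta> > 0 \<longleftrightarrow> col_fillings n (?v s) (Poly_Mapping.lookup ?\<beta>) \<noteq> {}"
      if "s \<in> covers n w r" for s
    proof -
      note c = cover_facts[OF w r(1) pre that]
      have "perm_weight n (?v s) < perm_weight n w" by (rule perm_weight_swap_less[OF c(3,2,1,4)])
      from less.hyps[OF this c(7), of ?\<beta>]
      show "coeff (schubert n (?v s)) ?\<beta> \<ge> 0"
        "coeff (schubert n (?v s)) ?\<beta> > 0 \<longleftrightarrow> col_fillings n (?v s) (Poly_Mapping.lookup ?\<beta>) \<noteq> {}"
        by blast+
    qed
    have "coeff (schubert n w) \<alpha> \<ge> 0" unfolding sum using IH(1) by (rule sum_nonneg)
    moreover have "coeff (schubert n w) \<alpha> = 0 \<longleftrightarrow> (\<forall>s \<in> covers n w r. coeff (schubert n (?v s)) ?\<beta> = 0)"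
      unfolding sum using IH(1) by (intro sum_nonneg_eq_0_iff) auto
    then have "coeff (schubert n w) \<alpha> > 0 \<longleftrightarrow> (\<exists>s \<in> covers n w r. coeff (schubert n (?v s)) ?\<beta> > 0)"
      using IH(1) calculation by (metis less_le)
    moreover have "\<dots> \<longleftrightarrow> (\<exists>s \<in> covers n w r. col_fillings n (?v s) (Poly_Mapping.lookup ?\<beta>) \<noteq> {})"
      using IH(2) by blast
    moreover have "\<dots> \<longleftrightarrow> col_fillings n w (Poly_Mapping.lookup \<alpha>) \<noteq> {}"
      unfolding \<beta> using col_fillings_from_cover[OF w r(1) pre] col_fillings_ex_cover[OF w r(1) pre lt] by blast
    ultimately show ?thesis by blast
  qed
qed

section \<open>From column sets to fillings of the diagram\<close>

lemma rothe_diagram_iff: "(i, j) \<in> rothe_diagram n w \<longleftrightarrow> j \<in> {1..n} \<and> i \<in> rothe_col n w j"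
  by (auto simp: rothe_diagram_def rothe_col_def)

lemma card_entries_eq:
  assumes "\<And>j. j \<in> {1..n} \<Longrightarrow> inj_on (\<lambda>i. \<tau> (i, j)) (rothe_col n w j)"
    and "\<And>j. j \<in> {1..n} \<Longrightarrow> E j = (\<lambda>i. \<tau> (i, j)) ` rothe_col n w j"
  shows "card {b \<in> rothe_diagram n w. \<tau> b = k} = card {j \<in> {1..n}. k \<in> E j}"
proof (rule bij_betw_same_card)
  show "bij_betw snd {b \<in> rothe_diagram n w. \<tau> b = k} {j \<in> {1..n}. k \<in> E j}"
    unfolding bij_betw_def
  proof
    show "inj_on snd {b \<in> rothe_diagram n w. \<tau> b = k}"
      using assms(1) by (force simp: inj_on_def rothe_diagram_iff)
    show "snd ` {b \<in> rothe_diagram n w. \<tau> b = k} = {j \<in> {1..n}. k \<in> E j}"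
      using assms(2) by (force simp: rothe_diagram_iff image_iff)
  qed
qed

text \<open>An entry in row \<open>i\<close> is at most \<open>i\<close>, so the boxes of a column
  up to row \<open>k\<close> hold distinct entries up to \<open>k\<close>; this is the inequality of
  prefix counts.\<close>

lemma col_fillings_of_perfect_tab:
  assumes \<tau>: "\<tau> \<in> perfect_tab n (rothe_diagram n w) \<alpha>" and \<alpha>: "Poly_Mapping.keys \<alpha> \<subseteq> {1..n}"
  shows "col_fillings n w (Poly_Mapping.lookup \<alpha>) \<noteq> {}"
proof -
  define E where "E j = (\<lambda>i. \<tau> (i, j)) ` rothe_col n w j" for j
  have inj: "inj_on (\<lambda>i. \<tau> (i, j)) (rothe_col n w j)" if "j \<in> {1..n}" for j
  proof -
    have "\<forall>i i' j. (i, j) \<in> rothe_diagram n w \<and> (i', j) \<in> rothe_diagram n w \<and> i \<noteq> i' \<longrightarrow> \<tau> (i, j) \<noteq> \<tau> (i', j)"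
      using \<tau> by (simp add: perfect_tab_def)
    then show ?thesis using that by (intro inj_onI) (metis rothe_diagram_iff)
  qed
  have mem: "\<tau> (i, j) \<in> {1..n}" "\<tau> (i, j) \<le> i" if "j \<in> {1..n}" "i \<in> rothe_col n w j" for i j
    using \<tau> that by (auto simp: perfect_tab_def rothe_diagram_iff PiE_def Pi_def)
  have "E j \<in> below (rothe_col n w j)" if j: "j \<in> {1..n}" for j
  proof -
    have "card (rothe_col n w j \<inter> {..k}) \<le> card (E j \<inter> {..k})" for k
    proof -
      have "card (rothe_col n w j \<inter> {..k}) = card ((\<lambda>i. \<tau> (i, j)) ` (rothe_col n w j \<inter> {..k}))"
        by (intro card_image[symmetric] inj_on_subset[OF inj[OF j]]) auto
      also have "\<dots> \<le> card (E j \<inter> {..k})"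
        using mem(2)[OF j] by (intro card_mono) (force simp: E_def)+
      finally show ?thesis .
    qed
    moreover have "0 \<notin> E j" using mem(1)[OF j] by (force simp: E_def)
    ultimately show ?thesis by (simp add: below_def E_def card_image[OF inj[OF j]])
  qed
  moreover have "card {j \<in> {1..n}. k \<in> E j} = Poly_Mapping.lookup \<alpha> k" for k
  proof (cases "k \<in> {1..n}")
    case True
    have "card {b \<in> rothe_diagram n w. \<tau> b = k} = card {j \<in> {1..n}. k \<in> E j}"
      by (rule card_entries_eq[OF inj]) (simp_all add: E_def)
    then show ?thesis using \<tau> True by (simp add: perfect_tab_def)
  next
    case False
    \<comment> \<open>\<open>perfect_tab\<close> fixes the content only for \<open>k\<close> in
      \<open>{1..n}\<close>; outside, the bound on the keys of \<alpha> makes both sides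
      zero.\<close>
    then have "{j \<in> {1..n}. k \<in> E j} = {}" using mem(1) by (auto simp: E_def)
    moreover have "Poly_Mapping.lookup \<alpha> k = 0" using \<alpha> False by (auto simp: in_keys_iff)
    ultimately show ?thesis by (simp only: card.empty)
  qed
  ultimately have "E \<in> col_fillings n w (Poly_Mapping.lookup \<alpha>)" by (simp add: col_fillings_def)
  then show ?thesis by blast
qed

lemma perfect_tab_less_of_col_fillings:
  assumes E: "E \<in> col_fillings n w (Poly_Mapping.lookup \<alpha>)"
  shows "perfect_tab_less n (rothe_diagram n w) \<alpha> \<noteq> {}"
proof -
  have below: "E j \<in> below (rothe_col n w j)" if "j \<in> {1..n}" for j
    using E that by (simp add: col_fillings_def)
  then have "\<forall>j \<in> {1..n}. \<exists>g. g ` rothe_col n w j = E j \<and>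
      (\<forall>i \<in> rothe_col n w j. \<forall>i' \<in> rothe_col n w j. i < i' \<longrightarrow> g i < g i') \<and> (\<forall>i \<in> rothe_col n w j. g i \<le> i)"
    by (intro ballI below_matching) simp_all
  from bchoice[OF this] obtain g where g: "\<forall>j \<in> {1..n}. g j ` rothe_col n w j = E j \<and>
      (\<forall>i \<in> rothe_col n w j. \<forall>i' \<in> rothe_col n w j. i < i' \<longrightarrow> g j i < g j i') \<and>
      (\<forall>i \<in> rothe_col n w j. g j i \<le> i)" ..
  define \<tau> where "\<tau> = restrict (\<lambda>(i, j). g j i) (rothe_diagram n w)"
  have \<tau>: "\<tau> (i, j) = g j i" if "j \<in> {1..n}" "i \<in> rothe_col n w j" for i j
    using that by (simp add: \<tau>_def rothe_diagram_iff)
  have less: "\<tau> (i, j) < \<tau> (i', j)" if "(i, j) \<in> rothe_diagram n w" "(i', j) \<in> rothe_diagram n w" "i < i'" for i i' j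
    using that g \<tau> by (simp add: rothe_diagram_iff)
  have ne: "\<tau> (i, j) \<noteq> \<tau> (i', j)" if "(i, j) \<in> rothe_diagram n w" "(i', j) \<in> rothe_diagram n w" "i \<noteq> i'" for i i' j
    using less[of i j i'] less[of i' j i] that by (cases i i' rule: linorder_cases) auto
  have img: "E j = (\<lambda>i. \<tau> (i, j)) ` rothe_col n w j" if "j \<in> {1..n}" for j
  proof -
    have "(\<lambda>i. \<tau> (i, j)) ` rothe_col n w j = g j ` rothe_col n w j"
      using \<tau>[OF that] by (intro image_cong) simp_all
    then show ?thesis using g that by simp
  qed
  have "\<tau> \<in> rothe_diagram n w \<rightarrow>\<^sub>E {1..n}"
  proof (rule PiE_I)
    fix b assume b: "b \<in> rothe_diagram n w"
    obtain i j where ij: "b = (i, j)" by fastforce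
    then have "j \<in> {1..n}" "i \<in> rothe_col n w j" using b by (simp_all add: rothe_diagram_iff)
    then have "\<tau> b \<in> E j" using img ij by blast
    then show "\<tau> b \<in> {1..n}" using below_subset[OF below rothe_col_subset] \<open>j \<in> {1..n}\<close> by blast
  qed (simp add: \<tau>_def)
  moreover have "card {b \<in> rothe_diagram n w. \<tau> b = k} = Poly_Mapping.lookup \<alpha> k" for k
  proof -
    have "card {b \<in> rothe_diagram n w. \<tau> b = k} = card {j \<in> {1..n}. k \<in> E j}"
    proof (rule card_entries_eq[OF _ img])
      show "inj_on (\<lambda>i. \<tau> (i, j)) (rothe_col n w j)" if "j \<in> {1..n}" for j
        using ne that by (auto simp: inj_on_def rothe_diagram_iff)
    qed
    then show ?thesis using E by (simp add: col_fillings_def)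
  qed
  moreover have "\<tau> (i, j) \<le> i" if "(i, j) \<in> rothe_diagram n w" for i j
    using that g \<tau> by (simp add: rothe_diagram_iff)
  ultimately have "\<tau> \<in> perfect_tab_less n (rothe_diagram n w) \<alpha>"
    unfolding perfect_tab_less_def perfect_tab_def using less ne by blast
  then show ?thesis by blast
qed

theorem theorem2p2:
  fixes n :: nat and w :: "nat \<Rightarrow> nat" and \<alpha> :: "nat \<Rightarrow>\<^sub>0 nat"
  assumes "w permutes {1..n}"
    and "Poly_Mapping.keys \<alpha> \<subseteq> {1..n}"
  shows "(coeff (schubert n w) \<alpha> > 0 \<longleftrightarrow> perfect_tab n (rothe_diagram n w) \<alpha> \<noteq> {}) \<and>
    (perfect_tab n (rothe_diagram n w) \<alpha> \<noteq> {} \<longleftrightarrow>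
      perfect_tab_less n (rothe_diagram n w) \<alpha> \<noteq> {})"
proof -
  have "perfect_tab_less n (rothe_diagram n w) \<alpha> \<subseteq> perfect_tab n (rothe_diagram n w) \<alpha>"
    by (auto simp: perfect_tab_less_def)
  moreover have "col_fillings n w (Poly_Mapping.lookup \<alpha>) \<noteq> {}"
    if "perfect_tab n (rothe_diagram n w) \<alpha> \<noteq> {}"
    using that col_fillings_of_perfect_tab[OF _ assms(2)] by blast
  moreover have "perfect_tab_less n (rothe_diagram n w) \<alpha> \<noteq> {}"
    if "col_fillings n w (Poly_Mapping.lookup \<alpha>) \<noteq> {}"
    using that perfect_tab_less_of_col_fillings by blast
  ultimately show ?thesis using coeff_schubert_pos_iff[OF assms(1)] by blast
qed

end
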